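(* Let $(X^{(\varepsilon)})_{\varepsilon\ge0}$ be an irreducibly perturbed Markov chain on a finite state space $S$. Let $E\ne S$ be a $P_0$-essential class of $X^{(\varepsilon)}$, and let $\tilde X^{(\varepsilon)}$, with path measure $\tilde{\mathbb P}_\varepsilon$, be the Markov chain where $E$ has been lifted. a) Let $A,B\subset S\setminus E$. Then for all $z\in S\setminus E$, $\mathbb P_\varepsilon^z(\tau_B<\tau_A)\simeq\tilde{\mathbb P}_\varepsilon^z(\tau_B<\tau_A)$, while for $z\in E$, $\mathbb P_\varepsilon^z(\tau_B<\tau_A)\simeq\tilde{\mathbb P}_\varepsilon^E(\tau_B<\tau_A)$. b) If $X^{(\varepsilon)}$ is regular, then $\tilde X^{(\varepsilon)}$ is a regular perturbed Markov chain. c) If $X^{(\varepsilon)}$ is regular, then either $E$ (as a state of $\tilde X^{(\varepsilon)}$) is a $\tilde P_0$-transient state, or $E$ is an element of a $\tilde P_0$-essential class that contains at least one further element $z\in F$. In the latter case, the number of $\tilde P_0$-transient states is strictly smaller than the number of $P_0$-transient states.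
   Context: Let $S$ be a finite set. For $\varepsilon\ge 0$ let $X^{(\varepsilon)}$ be a discrete time Markov chain on $S$ with transition matrix $P_\varepsilon=(p_\varepsilon(x,y))_{x,y\in S}$; $\mathbb P_\varepsilon^x$ is its path measure when started in $x$. The family is a perturbed Markov chain if $\lim_{\varepsilon\to0}p_\varepsilon(x,y)=p_0(x,y)$ for all $x,y\in S$, and an irreducibly perturbed Markov chain if in addition $X^{(\varepsilon)}$ is irreducible for every $\varepsilon>0$. For $A\subset S$, $\tau_A=\inf\{n\ge0:X_n\in A\}$, with $\inf\emptyset=\infty$; the same notation is used for every chain. The $P_0$-essential classes are the essential (closed) communicating classes of the chain with transition matrix $P_0$; states in none of them are $P_0$-transient, and $F$ is the set of $P_0$-transient states. For a $P_0$-essential class $E$, $\nu_E$ is the unique stationary distribution of the irreducible chain on $E$ with transition matrix $(p_0(x,y))_{x,y\in E}$. The same terminology is used for $\tilde P_0=\lim_{\varepsilon\to0}\tilde P_\varepsilon$ when this limit exists. Lifting: given a $P_0$-essential class $E\neq S$, the chain $\tilde X^{(\varepsilon)}$ ($\varepsilon>0$) where $E$ has been lifted is the Markov chain on $\tilde S=(S\setminus E)\cup\{E\}$ (all of $E$ replaced by one state called $E$) with transition matrix $\tilde P_\varepsilon$ given by $\tilde p_\varepsilon(x,y)=p_\varepsilon(x,y)$ for $x,y\in S\setminus E$ and, for $x\in S\setminus E$, $$\tilde p_\varepsilon(x,E)=\sum_{z\in E}p_\varepsilon(x,z),\quad \tilde p_\varepsilon(E,x)=\frac1{Z_\varepsilon(E)}\sum_{z\in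 E}\nu_E(z)p_\varepsilon(z,x),\quad \tilde p_\varepsilon(E,E)=0,$$ where $Z_\varepsilon(E)=\sum_{z\in E,\,y\notin E}\nu_E(z)p_\varepsilon(z,y)$. $\tilde{\mathbb P}_\varepsilon^z$ and $\tilde{\mathbb P}_\varepsilon^E$ denote its path measure when started in $z\in S\setminus E$ and in the state $E$, respectively. For this family, being a perturbed Markov chain means that the limits of all entries of $\tilde P_\varepsilon$ as $\varepsilon\to0$ exist; they define $\tilde P_0$. Asymptotic equivalence: for nonnegative functions $a_\varepsilon,b_\varepsilon$ of $\varepsilon$, $a_\varepsilon\simeq b_\varepsilon$ means that either both are identically zero, or there is $\varepsilon_0>0$ with $b_\varepsilon>0$ for all $\varepsilon\in(0,\varepsilon_0)$ and $\lim_{\varepsilon\to0}a_\varepsilon/b_\varepsilon=1$. Regularity: two functions $a_\varepsilon,b_\varepsilon$ of $\varepsilon>0$ satisfy $a_\varepsilon\sim b_\varepsilon$ if either both are strictly positive and $\lim_{\varepsilon\to0}a_\varepsilon/b_\varepsilon$ exists in $[0,\infty]$, or one or both of them are identically zero. An irreducibly perturbed Markov chain is regular if for all $m,n\in\mathbb N$ and all finite sequences of pairs of states $(x_i,y_i)_{i\le n}$, $(z_i,w_i)_{i\le m}$, $\prod_{i=1}^n p_\varepsilon(x_i,y_i)\sim\prod_{i=1}^m p_\varepsilon(z_i,w_i)$.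
   Formalization: In a), since probabilities may vanish for some arbitrarily small ε and not others, the equivalence is proved for all chains with 0/0 read as 1, and literally as ≃ when every entry p_ε(x,y) is identically zero or positive for all small ε. *)

theory Defs
  imports "HOL-Probability.Probability" "HOL-Library.Landau_Symbols"
begin

section \<open>Finite Markov chains on an explicit carrier\<close>

text \<open>
  A transition matrix is a function \<open>P :: 's \<Rightarrow> 's \<Rightarrow> real\<close> of which only the entries on a
  finite carrier \<open>S\<close> matter.
\<close>

definition stochastic :: "'s set \<Rightarrow> ('s \<Rightarrow> 's \<Rightarrow> real) \<Rightarrow> bool" where
  "stochastic S P \<longleftrightarrow> (\<forall>x\<in>S. (\<forall>y\<in>S. 0 \<le> P x y) \<and> (\<Sum>y\<in>S. P x y) = 1)"

primrec nstep :: "'s set \<Rightarrow> ('s \<Rightarrow> 's \<Rightarrow> real) \<Rightarrow> nat \<Rightarrow> 's \<Rightarrow> 's \<Rightarrow> real" where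
  "nstep S P 0 x y = (if x = y then 1 else 0)"
| "nstep S P (Suc n) x y = (\<Sum>z\<in>S. P x z * nstep S P n z y)"

definition leads_to :: "'s set \<Rightarrow> ('s \<Rightarrow> 's \<Rightarrow> real) \<Rightarrow> 's \<Rightarrow> 's \<Rightarrow> bool" where
  "leads_to S P x y \<longleftrightarrow> (\<exists>n. 0 < nstep S P n x y)"

definition irreducible_chain :: "'s set \<Rightarrow> ('s \<Rightarrow> 's \<Rightarrow> real) \<Rightarrow> bool" where
  "irreducible_chain S P \<longleftrightarrow> (\<forall>x\<in>S. \<forall>y\<in>S. leads_to S P x y)"

definition communicating :: "'s set \<Rightarrow> ('s \<Rightarrow> 's \<Rightarrow> real) \<Rightarrow> ('s \<times> 's) set" where
  "communicating S P = {(x, y). x \<in> S \<and> y \<in> S \<and> leads_to S P x y \<and> leads_to S P y x}"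

definition essential_class :: "'s set \<Rightarrow> ('s \<Rightarrow> 's \<Rightarrow> real) \<Rightarrow> 's set \<Rightarrow> bool" where
  "essential_class S P C \<longleftrightarrow>
     C \<in> S // communicating S P \<and> (\<forall>x\<in>C. \<forall>y\<in>S. leads_to S P x y \<longrightarrow> y \<in> C)"

definition transient_states :: "'s set \<Rightarrow> ('s \<Rightarrow> 's \<Rightarrow> real) \<Rightarrow> 's set" where
  "transient_states S P = {x \<in> S. \<nexists>C. essential_class S P C \<and> x \<in> C}"

text \<open>
  Distributions on \<open>E\<close> are extended by \<open>0\<close> outside \<open>E\<close>, so that uniqueness makes sense for
  functions on the whole type.
\<close>

definition is_stationary :: "'s set \<Rightarrow> ('s \<Rightarrow> 's \<Rightarrow> real) \<Rightarrow> ('s \<Rightarrow> real) \<Rightarrow> bool" where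
  "is_stationary E P \<nu> \<longleftrightarrow>
     (\<forall>x\<in>E. 0 \<le> \<nu> x) \<and> (\<forall>x. x \<notin> E \<longrightarrow> \<nu> x = 0) \<and> (\<Sum>x\<in>E. \<nu> x) = 1 \<and>
     (\<forall>y\<in>E. (\<Sum>x\<in>E. \<nu> x * P x y) = \<nu> y)"

definition stationary_dist :: "'s set \<Rightarrow> ('s \<Rightarrow> 's \<Rightarrow> real) \<Rightarrow> 's \<Rightarrow> real" where
  "stationary_dist E P = (THE \<nu>. is_stationary E P \<nu>)"


section \<open>Path measures and hitting times\<close>

text \<open>
  The path measure on \<open>S\<^sup>\<nat>\<close> is the Ionescu-Tulcea measure whose coordinate \<open>0\<close> is
  distributed as the Dirac mass at the starting point and whose coordinate \<open>n + 1\<close>, given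
  the past \<open>\<omega>\<close>, is distributed according to row \<open>\<omega> n\<close> of the transition matrix.
\<close>

definition path_kernel ::
  "'s set \<Rightarrow> ('s \<Rightarrow> 's \<Rightarrow> real) \<Rightarrow> 's \<Rightarrow> nat \<Rightarrow> (nat \<Rightarrow> 's) \<Rightarrow> 's measure" where
  "path_kernel S P x n \<omega> =
     (case n of 0 \<Rightarrow> return (count_space S) x
      | Suc m \<Rightarrow> point_measure S (\<lambda>y. ennreal (P (\<omega> m) y)))"

definition path_measure :: "'s set \<Rightarrow> ('s \<Rightarrow> 's \<Rightarrow> real) \<Rightarrow> 's \<Rightarrow> (nat \<Rightarrow> 's) measure" where
  "path_measure S P x =
     projective_family.lim UNIV
       (Ionescu_Tulcea.CI (path_kernel S P x) (\<lambda>_. count_space S)) (\<lambda>_. count_space S)"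

definition hitting_time :: "'s set \<Rightarrow> (nat \<Rightarrow> 's) \<Rightarrow> enat" where
  "hitting_time A \<omega> = Inf (enat ` {n. \<omega> n \<in> A})"

text \<open>\<open>prob_hits_before S P x B A\<close> is the probability of \<open>\<tau>\<^sub>B < \<tau>\<^sub>A\<close> for the chain started in \<open>x\<close>.\<close>

definition prob_hits_before ::
  "'s set \<Rightarrow> ('s \<Rightarrow> 's \<Rightarrow> real) \<Rightarrow> 's \<Rightarrow> 's set \<Rightarrow> 's set \<Rightarrow> real" where
  "prob_hits_before S P x B A =
     measure (path_measure S P x)
       {\<omega> \<in> space (path_measure S P x). hitting_time B \<omega> < hitting_time A \<omega>}"

lemma prob_space_transition_row:
  assumes "finite S" "stochastic S P" "x \<in> S"
  shows "prob_space (point_measure S (\<lambda>y. ennreal (P x y)))"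
proof (rule prob_spaceI)
  have "emeasure (point_measure S (\<lambda>y. ennreal (P x y))) S = (\<Sum>y\<in>S. ennreal (P x y))"
    using \<open>finite S\<close> by (rule emeasure_point_measure_finite) simp
  also have "\<dots> = ennreal (\<Sum>y\<in>S. P x y)"
    using assms by (intro sum_ennreal) (simp add: stochastic_def)
  also have "\<dots> = 1"
    using assms by (simp add: stochastic_def)
  finally show "emeasure (point_measure S (\<lambda>y. ennreal (P x y)))
      (space (point_measure S (\<lambda>y. ennreal (P x y)))) = 1"
    by (simp only: space_point_measure)
qed

lemma Ionescu_Tulcea_path_kernel:
  assumes "finite S" "stochastic S P" "x \<in> S"
  shows "Ionescu_Tulcea (path_kernel S P x) (\<lambda>_. count_space S)"
proof (rule Ionescu_Tulcea.intro)
  fix i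
  show "path_kernel S P x i \<in>
      measurable (PiM {0..<i} (\<lambda>_. count_space S)) (subprob_algebra (count_space S))"
  proof (cases i)
    case 0
    have "return (count_space S) x \<in> space (subprob_algebra (count_space S))"
      using \<open>x \<in> S\<close>
      by (simp add: space_subprob_algebra prob_space_imp_subprob_space prob_space_return)
    then have "(\<lambda>\<omega>. return (count_space S) x)
      \<in> measurable (PiM {0..<i} (\<lambda>_. count_space S)) (subprob_algebra (count_space S))"
      by (rule measurable_const)
    with 0 show ?thesis
      by (simp add: path_kernel_def[abs_def])
  next
    case (Suc m)
    have "(\<lambda>z. point_measure S (\<lambda>y. ennreal (P z y)))
        \<in> measurable (count_space S) (subprob_algebra (count_space S))"
      using prob_space_transition_row[OF assms(1,2)]
      by (simp add: measurable_count_space_eq1 Pi_iff space_subprob_algebra sets_point_measure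
          prob_space_imp_subprob_space)
    moreover have "(\<lambda>\<omega>. \<omega> m) \<in> measurable (PiM {0..<i} (\<lambda>_. count_space S)) (count_space S)"
      by (rule measurable_component_singleton) (simp add: Suc)
    ultimately have "(\<lambda>\<omega>. point_measure S (\<lambda>y. ennreal (P (\<omega> m) y)))
      \<in> measurable (PiM {0..<i} (\<lambda>_. count_space S)) (subprob_algebra (count_space S))"
      by (rule measurable_compose[rotated])
    with Suc show ?thesis
      by (simp add: path_kernel_def[abs_def])
  qed
next
  fix i :: nat and \<omega> assume \<omega>: "\<omega> \<in> space (PiM {0..<i} (\<lambda>_. count_space S))"
  show "prob_space (path_kernel S P x i \<omega>)"
  proof (cases i)
    case 0
    with \<open>x \<in> S\<close> show ?thesis by (simp add: path_kernel_def prob_space_return)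
  next
    case (Suc m)
    with \<omega> have "\<omega> m \<in> S" by (auto simp: space_PiM PiE_iff)
    with Suc prob_space_transition_row[OF assms(1,2)] show ?thesis
      by (simp add: path_kernel_def)
  qed
qed


section \<open>Perturbed Markov chains\<close>

text \<open>A family \<open>p\<close> of transition matrices is only considered for parameters \<open>\<epsilon> \<ge> 0\<close>.\<close>

definition perturbed_chain :: "'s set \<Rightarrow> (real \<Rightarrow> 's \<Rightarrow> 's \<Rightarrow> real) \<Rightarrow> bool" where
  "perturbed_chain S p \<longleftrightarrow>
     (\<forall>\<epsilon>\<ge>0. stochastic S (p \<epsilon>)) \<and>
     (\<forall>x\<in>S. \<forall>y\<in>S. ((\<lambda>\<epsilon>. p \<epsilon> x y) \<longlongrightarrow> p 0 x y) (at_right 0))"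

definition irreducibly_perturbed_chain :: "'s set \<Rightarrow> (real \<Rightarrow> 's \<Rightarrow> 's \<Rightarrow> real) \<Rightarrow> bool" where
  "irreducibly_perturbed_chain S p \<longleftrightarrow>
     perturbed_chain S p \<and> (\<forall>\<epsilon>>0. irreducible_chain S (p \<epsilon>))"

definition comparable :: "(real \<Rightarrow> real) \<Rightarrow> (real \<Rightarrow> real) \<Rightarrow> bool" where
  "comparable a b \<longleftrightarrow>
     (\<forall>\<epsilon>>0. 0 < a \<epsilon> \<and> 0 < b \<epsilon>) \<and>
       (\<exists>L::ennreal. ((\<lambda>\<epsilon>. ennreal (a \<epsilon> / b \<epsilon>)) \<longlongrightarrow> L) (at_right 0)) \<or>
     (\<forall>\<epsilon>>0. a \<epsilon> = 0) \<or> (\<forall>\<epsilon>>0. b \<epsilon> = 0)"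

definition regular_chain :: "'s set \<Rightarrow> (real \<Rightarrow> 's \<Rightarrow> 's \<Rightarrow> real) \<Rightarrow> bool" where
  "regular_chain S p \<longleftrightarrow>
     irreducibly_perturbed_chain S p \<and>
     (\<forall>us vs. set us \<subseteq> S \<times> S \<longrightarrow> set vs \<subseteq> S \<times> S \<longrightarrow>
        comparable (\<lambda>\<epsilon>. \<Prod>(x, y)\<leftarrow>us. p \<epsilon> x y) (\<lambda>\<epsilon>. \<Prod>(z, w)\<leftarrow>vs. p \<epsilon> z w))"

definition asymptotic_to :: "(real \<Rightarrow> real) \<Rightarrow> (real \<Rightarrow> real) \<Rightarrow> bool" where
  "asymptotic_to a b \<longleftrightarrow>
     (\<forall>\<epsilon>>0. a \<epsilon> = 0 \<and> b \<epsilon> = 0) \<or>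
     (\<exists>\<epsilon>\<^sub>0>0. \<forall>\<epsilon>. 0 < \<epsilon> \<and> \<epsilon> < \<epsilon>\<^sub>0 \<longrightarrow> 0 < b \<epsilon>) \<and>
       ((\<lambda>\<epsilon>. a \<epsilon> / b \<epsilon>) \<longlongrightarrow> 1) (at_right 0)"

text \<open>
  The dichotomy that \<open>asymptotic_to\<close> builds in: a function satisfies \<open>asymptotic_to a a\<close>
  iff \<open>zero_or_positive a\<close>. It is needed because a convergent irreducibly perturbed chain may
  have entries such as \<open>\<epsilon> * max 0 (sin (1 / \<epsilon>))\<close>, which vanish for some arbitrarily small
  \<open>\<epsilon>\<close> and are positive for others; hitting probabilities can then have the same behaviour.
  The library relation \<open>a \<sim>[at_right 0] b\<close>, which reads \<open>0 / 0\<close> as \<open>1\<close>, also covers such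
  functions, and agrees with \<open>asymptotic_to\<close> for \<open>b\<close> positive near \<open>0\<close>.
\<close>

definition zero_or_positive :: "(real \<Rightarrow> real) \<Rightarrow> bool" where
  "zero_or_positive a \<longleftrightarrow>
     (\<forall>\<epsilon>>0. a \<epsilon> = 0) \<or> (\<exists>\<epsilon>\<^sub>0>0. \<forall>\<epsilon>. 0 < \<epsilon> \<and> \<epsilon> < \<epsilon>\<^sub>0 \<longrightarrow> 0 < a \<epsilon>)"

lemma regular_chain_zero_or_positive:
  assumes "regular_chain S p" "x \<in> S" "y \<in> S"
  shows "zero_or_positive (\<lambda>\<epsilon>. p \<epsilon> x y)"
proof -
  have "comparable (\<lambda>\<epsilon>. \<Prod>(x, y)\<leftarrow>[(x, y)]. p \<epsilon> x y) (\<lambda>\<epsilon>. \<Prod>(z, w)\<leftarrow>[(x, y)]. p \<epsilon> z w)"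
    using assms unfolding regular_chain_def
    by (elim conjE) (drule spec[of _ "[(x, y)]"], drule spec[of _ "[(x, y)]"], simp)
  then have "comparable (\<lambda>\<epsilon>. p \<epsilon> x y) (\<lambda>\<epsilon>. p \<epsilon> x y)"
    by simp
  then show ?thesis
    unfolding comparable_def zero_or_positive_def by (metis zero_less_one)
qed


section \<open>Lifting an essential class\<close>

text \<open>In the lifted state space, \<open>Inl x\<close> is the old state \<open>x\<close> and \<open>Inr E\<close> is the class \<open>E\<close>.\<close>

definition lifted_space :: "'s set \<Rightarrow> 's set \<Rightarrow> ('s + 's set) set" where
  "lifted_space S E = (S - E) <+> {E}"

definition lift_Z :: "'s set \<Rightarrow> (real \<Rightarrow> 's \<Rightarrow> 's \<Rightarrow> real) \<Rightarrow> 's set \<Rightarrow> real \<Rightarrow> real" where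
  "lift_Z S p E \<epsilon> = (\<Sum>z\<in>E. \<Sum>y\<in>S - E. stationary_dist E (p 0) z * p \<epsilon> z y)"

fun lifted_matrix ::
  "'s set \<Rightarrow> (real \<Rightarrow> 's \<Rightarrow> 's \<Rightarrow> real) \<Rightarrow> 's set \<Rightarrow> real \<Rightarrow> 's + 's set \<Rightarrow> 's + 's set \<Rightarrow> real" where
  "lifted_matrix S p E \<epsilon> (Inl x) (Inl y) = p \<epsilon> x y"
| "lifted_matrix S p E \<epsilon> (Inl x) (Inr _) = (\<Sum>z\<in>E. p \<epsilon> x z)"
| "lifted_matrix S p E \<epsilon> (Inr _) (Inl x) =
     (1 / lift_Z S p E \<epsilon>) * (\<Sum>z\<in>E. stationary_dist E (p 0) z * p \<epsilon> z x)"
| "lifted_matrix S p E \<epsilon> (Inr _) (Inr _) = 0"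

text \<open>
  The formulas above are meant for \<open>\<epsilon> > 0\<close> (at \<open>\<epsilon> = 0\<close> the normalisation vanishes); the
  matrix at \<open>\<epsilon> = 0\<close> is the entrywise limit. That all these limits exist is part of
  \<open>perturbed_chain (lifted_space S E) (lifted_chain S p E)\<close>.
\<close>

definition lifted_chain ::
  "'s set \<Rightarrow> (real \<Rightarrow> 's \<Rightarrow> 's \<Rightarrow> real) \<Rightarrow> 's set \<Rightarrow> real \<Rightarrow> 's + 's set \<Rightarrow> 's + 's set \<Rightarrow> real" where
  "lifted_chain S p E \<epsilon> =
     (if \<epsilon> = 0 then \<lambda>u v. Lim (at_right 0) (\<lambda>\<delta>. lifted_matrix S p E \<delta> u v)
      else lifted_matrix S p E \<epsilon>)"

end

theory Submission
  imports Defs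
begin

text \<open>
  The hitting probability \<open>h\<close> of \<open>B\<close> before \<open>A\<close> solves a Dirichlet problem, and so does its lifted
  version \<open>h'\<close>. Off \<open>E\<close>, the latter equals \<open>r + h'(E) t\<close>, where \<open>r\<close> and \<open>t\<close> are the probabilities
  of hitting \<open>B\<close> before \<open>A \<union> E\<close> and \<open>E\<close> before \<open>A \<union> B\<close>, whereas \<open>h\<close> lies between \<open>r + m t\<close> and
  \<open>r + M t\<close>, with \<open>m\<close> and \<open>M\<close> the extrema of \<open>h\<close> on \<open>E\<close>. The exit distribution from \<open>E\<close> started at
  any state of \<open>E\<close> is that of the lifted chain with \<open>\<nu>\<close> replaced by the stationary distribution of a
  small perturbation of \<open>p 0\<close> on \<open>E\<close>, hence agrees with it up to factors tending to 1.
  Reading this off at the extremal states of \<open>E\<close> squeezes \<open>m\<close> and \<open>M\<close> around \<open>h'(E)\<close>.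

  For regularity, the entries of the lifted chain are quotients of nonnegative linear combinations
  of products of entries, and comparability passes to such combinations. In part c), every state
  that shares an essential class with the lifted state leads to \<open>E\<close>, so it was transient before,
  while recurrent states outside \<open>E\<close> stay recurrent.
\<close>

section \<open>Hitting probabilities and the Dirichlet problem\<close>

text \<open>The probabilities compared may tend to 0 with \<epsilon>, so every estimate has to be
  relative: factors \<open>1 - \<delta>\<close> and \<open>1 + \<delta>\<close> instead of additive
  errors. Compactness only gives absolute convergence of stationary distributions; this becomes
  relative because \<open>\<nu>\<close> is bounded away from 0 on the finite class. A second
  obstacle is that \<open>t\<close> may tend to 1, so that escape without return to \<open>E\<close>
  is itself a vanishing effect. The return term is therefore never estimated separately but moved to
  the other side. Writing \<open>\<nu>[g]\<close> for the unnormalised exit sum, the lifted chain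
  satisfies \<open>k * \<nu>[1 - t] = \<nu>[r]\<close> with \<open>k = h'(E)\<close>. At a minimal
  state of \<open>h\<close> on \<open>E\<close>, the perturbed weights \<open>\<mu>\<close> give
  \<open>\<mu>[r] \<le> m * \<mu>[1 - t]\<close>, and at a maximal state the reverse inequality with
  \<open>M\<close>. As \<open>r\<close> and \<open>1 - t\<close> are nonnegative, exchanging
  \<open>\<mu>\<close> and \<open>\<nu>\<close> costs only factors close to 1, however small the
  exit sums are. Division by \<open>\<nu>[1 - t]\<close> is legitimate for each fixed positive
  \<epsilon>, by irreducibility, as soon as \<open>A \<union> B\<close> is nonempty.\<close>

text \<open>
  The \<open>n\<close>-th iterate of \<open>killed_step S P (- (A \<union> B))\<close> at \<open>indicator (B - A)\<close> is the probability
  of hitting \<open>B\<close> before \<open>A\<close> at time \<open>n\<close> exactly, as a function of the starting point.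
\<close>

definition killed_step :: "'s set \<Rightarrow> ('s \<Rightarrow> 's \<Rightarrow> real) \<Rightarrow> 's set \<Rightarrow> ('s \<Rightarrow> ennreal) \<Rightarrow> 's \<Rightarrow> ennreal" where
  "killed_step S P N g z = indicator N z * (\<Sum>y\<in>S. ennreal (P z y) * g y)"

lemma killed_step_suminf:
  assumes "finite S"
  shows "killed_step S P N (\<lambda>y. \<Sum>n. f n y) z = (\<Sum>n. killed_step S P N (f n) z)"
proof -
  have "(\<Sum>n. killed_step S P N (f n) z) = indicator N z * (\<Sum>n. \<Sum>y\<in>S. ennreal (P z y) * f n y)"
    unfolding killed_step_def by (rule ennreal_suminf_cmult)
  also have "(\<Sum>n. \<Sum>y\<in>S. ennreal (P z y) * f n y) = (\<Sum>y\<in>S. \<Sum>n. ennreal (P z y) * f n y)"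
    by (rule suminf_sum) auto
  also have "\<dots> = (\<Sum>y\<in>S. ennreal (P z y) * (\<Sum>n. f n y))"
    by simp
  finally show ?thesis
    by (simp add: killed_step_def)
qed

lemma measurable_path_component:
  "(i :: nat) < n \<Longrightarrow> (\<lambda>\<omega>. (g :: 's \<Rightarrow> ennreal) (\<omega> i)) \<in> borel_measurable (PiM {0..<n} (\<lambda>_. count_space S))"
  by (rule measurable_compose[OF measurable_component_singleton]) auto

text \<open>Integrating out the last coordinate against its kernel turns the integrand for
  \<open>g\<close> at time \<open>n + 1\<close> into the one for \<open>killed_step S P N g\<close>
  at time \<open>n\<close>; hence the induction needs \<open>g\<close> arbitrary. The measure
  \<open>C 0 (Suc n)\<close> carries the coordinates 0 to \<open>n\<close>, since coordinate 0 is
  the starting point.\<close>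

lemma nn_integral_path_prefix:
  fixes g :: "'s \<Rightarrow> ennreal"
  assumes "finite S" "stochastic S P" "x \<in> S"
  shows "(\<integral>\<^sup>+\<omega>. (\<Prod>i<n. indicator N (\<omega> i)) * g (\<omega> n)
      \<partial>Ionescu_Tulcea.C (path_kernel S P x) (\<lambda>_. count_space S) 0 (Suc n) (\<lambda>_. undefined))
    = (killed_step S P N ^^ n) g x"
proof -
  interpret Ionescu_Tulcea "path_kernel S P x" "\<lambda>_. count_space S"
    by (rule Ionescu_Tulcea_path_kernel[OF assms])
  have und[simp]: "(\<lambda>_. undefined) \<in> space (PiM {0..<0::nat} (\<lambda>_. count_space S))"
    by (simp add: space_PiM PiE_def extensional_def)
  have M: "(\<lambda>\<omega>. (\<Prod>i<n. indicator N (\<omega> i)) * g (\<omega> n))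
      \<in> borel_measurable (PiM {0..<Suc n} (\<lambda>_. count_space S))" for g :: "'s \<Rightarrow> ennreal" and n
    by (intro borel_measurable_times_ennreal borel_measurable_prod_ennreal measurable_path_component)
      auto
  \<comment> \<open>The Ionescu-Tulcea construction appends one kernel at a time, so the newest
    coordinate is the inner integral and the earlier ones are fixed.\<close>
  have step: "(\<integral>\<^sup>+\<omega>. (\<Prod>i<n. indicator N (\<omega> i)) * g (\<omega> n) \<partial>C 0 (Suc n) (\<lambda>_. undefined))
      = (\<integral>\<^sup>+\<omega>. \<integral>\<^sup>+y. (\<Prod>i<n. indicator N (\<omega> i)) * g y \<partial>path_kernel S P x n \<omega>
           \<partial>C 0 n (\<lambda>_. undefined))" for g :: "'s \<Rightarrow> ennreal" and n
  proof -
    have "(\<integral>\<^sup>+\<omega>. (\<Prod>i<n. indicator N (\<omega> i)) * g (\<omega> n) \<partial>C 0 (Suc n) (\<lambda>_. undefined))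
      = (\<integral>\<^sup>+\<omega>. \<integral>\<^sup>+\<omega>'. (\<Prod>i<n. indicator N (\<omega>' i)) * g (\<omega>' n) \<partial>eP n \<omega> \<partial>C 0 n (\<lambda>_. undefined))"
      using M[of n g] measurable_eP[of n]
      by (simp, subst nn_integral_bind[where B="PiM {0..<Suc n} (\<lambda>_. count_space S)"])
        (auto simp: measurable_cong_sets[OF sets_C[OF und, of n, simplified] refl])
    also have "\<dots> = (\<integral>\<^sup>+\<omega>. \<integral>\<^sup>+y. (\<Prod>i<n. indicator N (\<omega> i)) * g y \<partial>path_kernel S P x n \<omega>
        \<partial>C 0 n (\<lambda>_. undefined))"
      using M[of n g] by (intro nn_integral_cong) (simp add: space_C nn_integral_eP)
    finally show ?thesis .
  qed
  show ?thesis
  proof (induction n arbitrary: g)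
    case 0
    have "(\<integral>\<^sup>+\<omega>. g (\<omega> 0) \<partial>C 0 (Suc 0) (\<lambda>_. undefined))
      = (\<integral>\<^sup>+\<omega>. \<integral>\<^sup>+y. g y \<partial>return (count_space S) x \<partial>return (PiM {0..<0::nat} (\<lambda>_. count_space S)) (\<lambda>_. undefined))"
      using step[of 0 g] by (simp add: path_kernel_def)
    also have "\<dots> = g x"
      using \<open>x \<in> S\<close> by (simp add: nn_integral_return)
    finally show ?case by simp
  next
    case (Suc n)
    have "(\<integral>\<^sup>+\<omega>. (\<Prod>i<Suc n. indicator N (\<omega> i)) * g (\<omega> (Suc n)) \<partial>C 0 (Suc (Suc n)) (\<lambda>_. undefined))
      = (\<integral>\<^sup>+\<omega>. (\<Prod>i<n. indicator N (\<omega> i)) * killed_step S P N g (\<omega> n) \<partial>C 0 (Suc n) (\<lambda>_. undefined))"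
      unfolding step[of "Suc n" g]
      using \<open>finite S\<close>
      by (intro nn_integral_cong)
        (simp add: path_kernel_def nn_integral_point_measure_finite killed_step_def
          sum_distrib_left mult_ac)
    then show ?case
      by (simp only: Suc.IH funpow_Suc_right o_def)
  qed
qed

text \<open>The witness is the first visit to \<open>B\<close>. Strictness of the inequality
  excludes a simultaneous visit to \<open>A\<close>, whence \<open>B - A\<close>; the value of
  \<open>Inf {}\<close> is top, so \<open>\<tau>_B\<close> must be finite while \<open>A\<close> may
  never be visited.\<close>

lemma hitting_time_less_iff:
  "hitting_time B \<omega> < hitting_time A \<omega> \<longleftrightarrow> (\<exists>n. \<omega> n \<in> B - A \<and> (\<forall>i<n. \<omega> i \<notin> A \<union> B))"
proof
  assume *: "hitting_time B \<omega> < hitting_time A \<omega>"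
  define n where "n = (LEAST n. \<omega> n \<in> B)"
  have "{n. \<omega> n \<in> B} \<noteq> {}"
    using * by (intro notI) (simp add: hitting_time_def)
  then have B: "\<omega> n \<in> B" "\<And>i. i < n \<Longrightarrow> \<omega> i \<notin> B"
    unfolding n_def by (auto intro: LeastI dest: not_less_Least)
  have "enat n \<le> hitting_time B \<omega>"
    unfolding hitting_time_def
  proof (rule Inf_greatest)
    fix k assume "k \<in> enat ` {n. \<omega> n \<in> B}"
    then show "enat n \<le> k" using B(2) by (force simp: not_le[symmetric])
  qed
  moreover have "hitting_time A \<omega> \<le> enat i" if "\<omega> i \<in> A" for i
    using that unfolding hitting_time_def by (intro Inf_lower) auto
  ultimately have "\<not> i \<le> n" if "\<omega> i \<in> A" for i
    using * that by (meson enat_ord_simps(1) leD order.strict_trans1 order.trans)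
  with B show "\<exists>n. \<omega> n \<in> B - A \<and> (\<forall>i<n. \<omega> i \<notin> A \<union> B)"
    by (intro exI[of _ n]) (auto dest: less_imp_le)
next
  assume "\<exists>n. \<omega> n \<in> B - A \<and> (\<forall>i<n. \<omega> i \<notin> A \<union> B)"
  then obtain n where n: "\<omega> n \<in> B" "\<omega> n \<notin> A" "\<And>i. i < n \<Longrightarrow> \<omega> i \<notin> A" by auto
  have "hitting_time B \<omega> \<le> enat n"
    using n(1) unfolding hitting_time_def by (intro Inf_lower) auto
  also have "enat n < enat (Suc n)" by simp
  also have "enat (Suc n) \<le> hitting_time A \<omega>"
    unfolding hitting_time_def
  proof (rule Inf_greatest)
    fix k assume "k \<in> enat ` {n. \<omega> n \<in> A}"
    then obtain i where "k = enat i" "\<omega> i \<in> A" by auto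
    with n(2,3) show "enat (Suc n) \<le> k" by (metis enat_ord_simps(1) linorder_neqE_nat not_less_eq_eq not_le)
  qed
  finally show "hitting_time B \<omega> < hitting_time A \<omega>" .
qed

text \<open>Sorting paths by the time of the first visit to \<open>A \<union> B\<close> makes the
  event a disjoint union of cylinder sets, each depending on finitely many coordinates and evaluated
  by \<open>nn_integral_path_prefix\<close>.\<close>

lemma path_measure_hits_before:
  assumes "finite S" "stochastic S P" "x \<in> S"
  shows "ennreal (prob_hits_before S P x B A)
      = (\<Sum>n. (killed_step S P (- (A \<union> B)) ^^ n) (indicator (B - A)) x)"
    and "prob_hits_before S P x B A \<le> 1"
proof -
  interpret Ionescu_Tulcea "path_kernel S P x" "\<lambda>_. count_space S"
    by (rule Ionescu_Tulcea_path_kernel[OF assms(1-3)])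
  have PM: "path_measure S P x = PF.lim"
    by (simp add: path_measure_def)
  let ?L = "path_measure S P x"
  \<comment> \<open>The cylinder over the empty index set is the whole path space, which reduces
    total mass 1 to a finite-dimensional marginal.\<close>
  have "PF.emb UNIV {} (space (PiM {} (\<lambda>_. count_space S))) = space (PiM UNIV (\<lambda>_. count_space S))"
    by (auto simp: prod_emb_def space_PiM)
  then have "emeasure ?L (space ?L) = emeasure (CI {}) (space (CI {}))"
    using lim[of "{}", OF finite.emptyI sets.top] by (simp only: PM PF.space_lim PF.space_P finite.emptyI subset_UNIV)
  also have "\<dots> = 1"
    by (intro prob_space.emeasure_space_1 PF.prob_space_P) auto
  finally have L1: "emeasure ?L (space ?L) = 1" .
  interpret L: prob_space ?L by (rule prob_spaceI) fact
  define X where "X n = {\<omega> \<in> space (PiM {0..<Suc n} (\<lambda>_. count_space S)).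
      \<omega> n \<in> B - A \<and> (\<forall>i<n. \<omega> i \<notin> A \<union> B)}" for n
  have ind: "indicator (X n) \<omega> = (\<Prod>i<n. indicator (- (A \<union> B)) (\<omega> i)) * (indicator (B - A) (\<omega> n) :: ennreal)"
    if "\<omega> \<in> space (PiM {0..<Suc n} (\<lambda>_. count_space S))" for \<omega> n
  proof -
    have "(\<Prod>i<n. indicator (- (A \<union> B)) (\<omega> i)) = (if \<forall>i<n. \<omega> i \<notin> A \<union> B then 1 else 0 :: ennreal)"
      by (induction n) (auto simp: less_Suc_eq)
    then show ?thesis using that by (auto simp: X_def indicator_def)
  qed
  have [measurable]: "X n \<in> sets (PiM {0..<Suc n} (\<lambda>_. count_space S))" for n
  proof -
    have C: "{\<omega> \<in> space (PiM {0..<Suc n} (\<lambda>_. count_space S)). \<omega> i \<in> Y}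
        \<in> sets (PiM {0..<Suc n} (\<lambda>_. count_space S))" if "i < Suc n" for i Y
    proof -
      have "(\<lambda>\<omega>. \<omega> i) -` (Y \<inter> S) \<inter> space (PiM {0..<Suc n} (\<lambda>_. count_space S))
          \<in> sets (PiM {0..<Suc n} (\<lambda>_. count_space S))"
        using that by (intro measurable_sets[OF measurable_component_singleton]) auto
      also have "(\<lambda>\<omega>. \<omega> i) -` (Y \<inter> S) \<inter> space (PiM {0..<Suc n} (\<lambda>_. count_space S))
          = {\<omega> \<in> space (PiM {0..<Suc n} (\<lambda>_. count_space S)). \<omega> i \<in> Y}"
        using that by (auto simp: space_PiM PiE_def extensional_def)
      finally show ?thesis .
    qed
    have "X n = {\<omega> \<in> space (PiM {0..<Suc n} (\<lambda>_. count_space S)). \<omega> n \<in> B - A} \<inter>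
        {\<omega> \<in> space (PiM {0..<Suc n} (\<lambda>_. count_space S)). \<forall>i\<in>{..<n}. \<omega> i \<in> - (A \<union> B)}"
      by (auto simp: X_def)
    also have "\<dots> \<in> sets (PiM {0..<Suc n} (\<lambda>_. count_space S))"
      by (intro sets.Int C sets.sets_Collect_finite_All) auto
    finally show ?thesis .
  qed
  define Y where "Y n = PF.emb UNIV {0..<Suc n} (X n)" for n
  have Y: "Y n \<in> sets ?L" for n
    unfolding Y_def PM by (simp add: measurable_prod_emb)
  have Y_eq: "Y n = {\<omega> \<in> space ?L. \<omega> n \<in> B - A \<and> (\<forall>i<n. \<omega> i \<notin> A \<union> B)}" for n
    unfolding Y_def PM by (auto simp: prod_emb_def X_def space_PiM PiE_iff)
  have emY: "emeasure ?L (Y n) = (killed_step S P (- (A \<union> B)) ^^ n) (indicator (B - A)) x" for n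
  proof -
    have "emeasure ?L (Y n) = emeasure (CI {0..<Suc n}) (X n)"
      unfolding Y_def PM by (rule lim) auto
    also have "\<dots> = emeasure (C 0 (Suc n) (\<lambda>_. undefined)) (PF.emb {0..<Suc n} {0..<Suc n} (X n))"
      by (rule emeasure_CI) auto
    also have "PF.emb {0..<Suc n} {0..<Suc n} (X n) = X n"
      by (rule prod_emb_id) (auto simp: X_def space_PiM)
    also have "emeasure (C 0 (Suc n) (\<lambda>_. undefined)) (X n)
        = (\<integral>\<^sup>+\<omega>. indicator (X n) \<omega> \<partial>C 0 (Suc n) (\<lambda>_. undefined))"
      by (subst nn_integral_indicator) (auto simp: sets_C simp del: C.simps)
    also have "\<dots> = (\<integral>\<^sup>+\<omega>. (\<Prod>i<n. indicator (- (A \<union> B)) (\<omega> i)) * indicator (B - A) (\<omega> n)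
        \<partial>C 0 (Suc n) (\<lambda>_. undefined))"
      by (intro nn_integral_cong ind) (simp add: space_C del: C.simps)
    also have "\<dots> = (killed_step S P (- (A \<union> B)) ^^ n) (indicator (B - A)) x"
      by (rule nn_integral_path_prefix) fact+
    finally show ?thesis .
  qed
  have disj: "disjoint_family Y"
    unfolding disjoint_family_on_def
  proof (intro ballI impI, rule ccontr)
    fix i j assume "i \<noteq> j" "Y i \<inter> Y j \<noteq> {}"
    then show False unfolding Y_eq
      by (cases i j rule: linorder_cases) auto
  qed
  have ev: "{\<omega> \<in> space ?L. hitting_time B \<omega> < hitting_time A \<omega>} = (\<Union>n. Y n)"
    unfolding hitting_time_less_iff Y_eq by auto
  show "ennreal (prob_hits_before S P x B A)
      = (\<Sum>n. (killed_step S P (- (A \<union> B)) ^^ n) (indicator (B - A)) x)"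
    unfolding prob_hits_before_def ev L.emeasure_eq_measure[symmetric] emY[symmetric]
    using Y disj by (intro suminf_emeasure[symmetric]) auto
  show "prob_hits_before S P x B A \<le> 1"
    unfolding prob_hits_before_def by (rule L.prob_le_1)
qed

lemma prob_hits_before_nonneg: "0 \<le> prob_hits_before S P x B A"
  by (simp add: prob_hits_before_def)

text \<open>Splitting off the term \<open>n = 0\<close> of the series leaves one killed step applied
  to the series itself. All three claims are read off from this single identity by the two
  indicators; working in \<open>ennreal\<close> makes every rearrangement unconditional.\<close>

theorem prob_hits_before_dirichlet:
  assumes "finite S" "stochastic S P" "x \<in> S"
  shows "x \<in> A \<Longrightarrow> prob_hits_before S P x B A = 0"
    and "x \<in> B \<Longrightarrow> x \<notin> A \<Longrightarrow> prob_hits_before S P x B A = 1"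
    and "x \<notin> A \<Longrightarrow> x \<notin> B \<Longrightarrow>
      prob_hits_before S P x B A = (\<Sum>y\<in>S. P x y * prob_hits_before S P y B A)"
proof -
  let ?T = "killed_step S P (- (A \<union> B))" and ?h = "\<lambda>x. prob_hits_before S P x B A"
  have h: "ennreal (?h z) = (\<Sum>n. (?T ^^ n) (indicator (B - A)) z)" if "z \<in> S" for z
    using path_measure_hits_before(1)[OF assms(1,2) that] .
  have "(\<Sum>n. (?T ^^ n) (indicator (B - A)) x) = indicator (B - A) x + (\<Sum>n. (?T ^^ Suc n) (indicator (B - A)) x)"
    using suminf_offset[of "\<lambda>n. (?T ^^ n) (indicator (B - A)) x" 1] by (simp add: summableI)
  also have "(\<Sum>n. (?T ^^ Suc n) (indicator (B - A)) x) = ?T (\<lambda>y. \<Sum>n. (?T ^^ n) (indicator (B - A)) y) x"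
    by (simp add: killed_step_suminf[OF assms(1)])
  also have "\<dots> = indicator (- (A \<union> B)) x * (\<Sum>y\<in>S. ennreal (P x y) * ennreal (?h y))"
    using h by (simp add: killed_step_def[of S P _ "\<lambda>y. suminf (F y)" for F])
  also have "(\<Sum>y\<in>S. ennreal (P x y) * ennreal (?h y)) = ennreal (\<Sum>y\<in>S. P x y * ?h y)"
    using assms(2,3) prob_hits_before_nonneg[of S P _ B A]
    by (subst sum_ennreal[symmetric]) (auto simp: stochastic_def ennreal_mult intro!: sum.cong)
  finally have *: "ennreal (?h x) = indicator (B - A) x + indicator (- (A \<union> B)) x * ennreal (\<Sum>y\<in>S. P x y * ?h y)"
    using h[OF assms(3)] by simp
  show "?h x = 0" if "x \<in> A"
    using * that prob_hits_before_nonneg[of S P x B A] by (simp add: indicator_def)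
  show "?h x = 1" if "x \<in> B" "x \<notin> A"
    using * that by (simp add: indicator_def)
  have "0 \<le> (\<Sum>y\<in>S. P x y * ?h y)"
    using assms(2,3) prob_hits_before_nonneg[of S P _ B A]
    by (intro sum_nonneg mult_nonneg_nonneg) (auto simp: stochastic_def)
  then show "?h x = (\<Sum>y\<in>S. P x y * ?h y)" if "x \<notin> A" "x \<notin> B"
    using * that prob_hits_before_nonneg[of S P x B A] by (simp add: indicator_def)
qed

section \<open>Closed sets and stationary distributions\<close>

text \<open>Closedness is tested on single edges, so later arguments about reachability and
  irreducibility need no matrix powers.\<close>

definition closed_set :: "'s set \<Rightarrow> ('s \<Rightarrow> 's \<Rightarrow> real) \<Rightarrow> 's set \<Rightarrow> bool" where
  "closed_set S P C \<longleftrightarrow> C \<subseteq> S \<and> (\<forall>x\<in>C. \<forall>y\<in>S. 0 < P x y \<longrightarrow> y \<in> C)"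

section \<open>Matrix powers, reachability and closed sets\<close>

lemma stochastic_nonneg: "stochastic S P \<Longrightarrow> x \<in> S \<Longrightarrow> y \<in> S \<Longrightarrow> 0 \<le> P x y"
  and stochastic_sum: "stochastic S P \<Longrightarrow> x \<in> S \<Longrightarrow> (\<Sum>y\<in>S. P x y) = 1"
  by (auto simp: stochastic_def)

lemma stochastic_le_1:
  assumes "finite S" "stochastic S P" "x \<in> S" "y \<in> S"
  shows "P x y \<le> 1"
proof -
  have "P x y \<le> (\<Sum>y\<in>S. P x y)"
    using assms by (intro member_le_sum) (auto simp: stochastic_nonneg)
  then show ?thesis using assms by (simp add: stochastic_sum)
qed

lemma nstep_nonneg:
  "stochastic S P \<Longrightarrow> x \<in> S \<Longrightarrow> y \<in> S \<Longrightarrow> 0 \<le> nstep S P n x y"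
  by (induction n arbitrary: x) (auto intro!: sum_nonneg simp: stochastic_nonneg)

lemma nstep_Suc_right:
  assumes "finite S" "x \<in> S" "y \<in> S"
  shows "nstep S P (Suc n) x y = (\<Sum>z\<in>S. nstep S P n x z * P z y)"
  using assms(2)
proof (induction n arbitrary: x)
  case 0
  have "(\<Sum>z\<in>S. P x z * (if z = y then 1 else 0)) = P x y"
    "(\<Sum>z\<in>S. (if x = z then 1 else 0) * P z y) = P x y"
    using assms(1,3) 0 by (simp_all add: mult_delta_left mult_delta_right)
  then show ?case by simp
next
  case (Suc n)
  have "nstep S P (Suc (Suc n)) x y = (\<Sum>w\<in>S. P x w * (\<Sum>z\<in>S. nstep S P n w z * P z y))"
    using Suc.IH by simp
  also have "\<dots> = (\<Sum>w\<in>S. \<Sum>z\<in>S. P x w * nstep S P n w z * P z y)"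
    by (simp add: sum_distrib_left mult_ac)
  also have "\<dots> = (\<Sum>z\<in>S. \<Sum>w\<in>S. P x w * nstep S P n w z * P z y)"
    by (rule sum.swap)
  also have "\<dots> = (\<Sum>z\<in>S. nstep S P (Suc n) x z * P z y)"
    by (simp add: sum_distrib_right)
  finally show ?case .
qed

lemma nstep_row_sum:
  assumes "finite S" "stochastic S P" "x \<in> S"
  shows "(\<Sum>y\<in>S. nstep S P n x y) = 1"
  using assms(3)
proof (induction n arbitrary: x)
  case 0
  then show ?case using assms(1) by (simp add: sum.delta)
next
  case (Suc n)
  have "(\<Sum>y\<in>S. nstep S P (Suc n) x y) = (\<Sum>z\<in>S. \<Sum>y\<in>S. P x z * nstep S P n z y)"
    by (simp, rule sum.swap)
  also have "\<dots> = (\<Sum>z\<in>S. P x z)"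
    using Suc.IH by (simp add: sum_distrib_left[symmetric])
  finally show ?case using Suc.prems assms(2) by (simp add: stochastic_sum)
qed

lemma leads_to_closed_set:
  assumes "stochastic S P" "closed_set S P C" "x \<in> C" "leads_to S P x y"
  shows "y \<in> C"
proof -
  obtain n where "0 < nstep S P n x y" using assms(4) by (auto simp: leads_to_def)
  then show ?thesis using assms(3)
  proof (induction n arbitrary: x)
    case 0
    then show ?case by (auto split: if_splits)
  next
    case (Suc n)
    have "\<exists>z\<in>S. 0 < P x z * nstep S P n z y"
      using sum_nonpos[of S "\<lambda>z. P x z * nstep S P n z y"] Suc.prems(1)
      by (force simp: not_less[symmetric])
    then obtain z where z: "z \<in> S" "0 < P x z * nstep S P n z y" by blast
    moreover have "0 \<le> P x z"
      using assms(2) z Suc.prems by (intro stochastic_nonneg[OF assms(1)]) (auto simp: closed_set_def)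
    ultimately have *: "0 < P x z" "0 < nstep S P n z y"
      by (auto simp: zero_less_mult_iff)
    with z Suc.prems assms(2) have "z \<in> C" by (simp add: closed_set_def)
    with Suc.IH *(2) show ?case by blast
  qed
qed

lemma leads_to_refl: "leads_to S P x x"
  unfolding leads_to_def by (rule exI[of _ 0]) simp

lemma closed_set_reachable:
  assumes "finite S" "stochastic S P" "x \<in> S"
  shows "closed_set S P {y \<in> S. leads_to S P x y}"
  unfolding closed_set_def
proof (intro conjI ballI impI)
  fix y z assume y: "y \<in> {y \<in> S. leads_to S P x y}" and z: "z \<in> S" "0 < P y z"
  then obtain n where n: "0 < nstep S P n x y" by (auto simp: leads_to_def)
  have "0 < nstep S P n x y * P y z" using n z by simp
  also have "\<dots> \<le> nstep S P (Suc n) x z"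
    unfolding nstep_Suc_right[OF assms(1,3) z(1)]
    using y z assms by (intro member_le_sum[of y S "\<lambda>y. nstep S P n x y * P y z"])
      (auto simp: nstep_nonneg stochastic_nonneg)
  finally have "leads_to S P x z"
    unfolding leads_to_def by (rule exI)
  with z(1) show "z \<in> {y \<in> S. leads_to S P x y}" by simp
qed auto

lemma leads_to_in:
  assumes "stochastic S P" "x \<in> S" "leads_to S P x y"
  shows "y \<in> S"
  using leads_to_closed_set[OF assms(1) _ assms(2,3)] by (simp add: closed_set_def)

lemma leads_to_trans:
  assumes "finite S" "stochastic S P" "x \<in> S" "leads_to S P x y" "leads_to S P y z"
  shows "leads_to S P x z"
  using leads_to_closed_set[OF assms(2) closed_set_reachable[OF assms(1-3)] _ assms(5)]
    leads_to_in[OF assms(2-4)] assms(4) by simp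

text \<open>A closed set contains everything reachable from it, and the set reachable from a state
  is closed. Irreducibility is used in this form below: a nonempty set shown to be closed must be
  everything.\<close>

lemma irreducible_iff_closed_set:
  assumes "finite S" "stochastic S P"
  shows "irreducible_chain S P \<longleftrightarrow> (\<forall>C. closed_set S P C \<longrightarrow> C \<noteq> {} \<longrightarrow> C = S)"
proof
  assume irr: "irreducible_chain S P"
  show "\<forall>C. closed_set S P C \<longrightarrow> C \<noteq> {} \<longrightarrow> C = S"
  proof (intro allI impI)
    fix C assume C: "closed_set S P C" "C \<noteq> {}"
    then obtain x where x: "x \<in> C" by auto
    then have "y \<in> C" if "y \<in> S" for y
      using leads_to_closed_set[OF assms(2) C(1) x] irr C(1) that
      by (auto simp: irreducible_chain_def closed_set_def)
    with C show "C = S" by (auto simp: closed_set_def)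
  qed
next
  assume *: "\<forall>C. closed_set S P C \<longrightarrow> C \<noteq> {} \<longrightarrow> C = S"
  show "irreducible_chain S P"
    unfolding irreducible_chain_def
  proof (intro ballI)
    fix x y assume "x \<in> S" "y \<in> S"
    moreover have "closed_set S P {y \<in> S. leads_to S P x y}" "x \<in> {y \<in> S. leads_to S P x y}"
      using \<open>x \<in> S\<close> closed_set_reachable[OF assms] leads_to_refl[of S P x] by auto
    ultimately have "{y \<in> S. leads_to S P x y} = S" using * by blast
    with \<open>y \<in> S\<close> show "leads_to S P x y" by blast
  qed
qed

text \<open>If the minimum were negative, it would be attained only off \<open>D\<close>, where the
  averaging inequality forces all successors to attain it too. The set of minimisers is then closed,
  hence all of \<open>S\<close>, and meets \<open>D\<close>.\<close>

lemma minimum_principle: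
  assumes "finite S" "stochastic S P" "irreducible_chain S P" "D \<inter> S \<noteq> {}"
    and D: "\<And>x. x \<in> S \<Longrightarrow> x \<in> D \<Longrightarrow> 0 \<le> f x"
    and sup: "\<And>x. x \<in> S \<Longrightarrow> x \<notin> D \<Longrightarrow> (\<Sum>y\<in>S. P x y * f y) \<le> f x"
    and x: "x \<in> S"
  shows "0 \<le> f x"
proof -
  define m where "m = Min (f ` S)"
  have m: "m \<le> f y" if "y \<in> S" for y
    unfolding m_def using that assms(1) by auto
  have "0 \<le> m"
  proof (rule ccontr)
    assume "\<not> 0 \<le> m"
    define C where "C = {y \<in> S. f y = m}"
    have "m \<in> f ` S" unfolding m_def using assms(1) x by (intro Min_in) auto
    then have "C \<noteq> {}" by (auto simp: C_def)
    moreover have "closed_set S P C"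
      unfolding closed_set_def
    proof (intro conjI ballI impI)
      fix y z assume y: "y \<in> C" and z: "z \<in> S" "0 < P y z"
      have y': "y \<in> S" "f y = m" "y \<notin> D"
        using y D \<open>\<not> 0 \<le> m\<close> by (auto simp: C_def)
      have "P y z * (f z - m) \<le> (\<Sum>z\<in>S. P y z * (f z - m))"
        using assms(1,2) y' z m by (intro member_le_sum) (auto simp: stochastic_nonneg)
      also have "\<dots> = (\<Sum>z\<in>S. P y z * f z) - (\<Sum>z\<in>S. P y z) * m"
        by (simp add: right_diff_distrib sum_subtractf sum_distrib_right)
      also have "\<dots> \<le> 0"
        using sup[OF y'(1,3)] y' stochastic_sum[OF assms(2), of y] by simp
      finally have "f z \<le> m"
        using z(2) by (simp add: mult_le_0_iff)
      with m[of z] z show "z \<in> C" by (auto simp: C_def)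
    qed (auto simp: C_def)
    ultimately have "C = S"
      using assms(3) irreducible_iff_closed_set[OF assms(1,2)] by auto
    moreover obtain y where "y \<in> D" "y \<in> S" using assms(4) by auto
    ultimately show False using D[of y] \<open>\<not> 0 \<le> m\<close> by (auto simp: C_def)
  qed
  with m[OF x] show ?thesis by simp
qed

section \<open>Stationary distributions: existence, positivity, uniqueness, stability\<close>

lemma finite_pointwise_convergent_subsequence:
  fixes f :: "nat \<Rightarrow> 's \<Rightarrow> real"
  assumes "finite E" "\<And>n x. x \<in> E \<Longrightarrow> 0 \<le> f n x \<and> f n x \<le> 1"
  shows "\<exists>r l. strict_mono (r :: nat \<Rightarrow> nat) \<and> (\<forall>x\<in>E. (\<lambda>n. f (r n) x) \<longlonglongrightarrow> l x)"
  using assms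
proof (induction E rule: finite_induct)
  case empty
  show ?case by (auto intro: exI[of _ id] strict_mono_id simp: strict_mono_def)
next
  case (insert a E)
  from insert.IH insert.prems
  have "\<exists>r l. strict_mono (r :: nat \<Rightarrow> nat) \<and> (\<forall>x\<in>E. (\<lambda>n. f (r n) x) \<longlonglongrightarrow> l x)"
    by blast
  then obtain r l where r: "strict_mono (r :: nat \<Rightarrow> nat)" "\<And>x. x \<in> E \<Longrightarrow> (\<lambda>n. f (r n) x) \<longlonglongrightarrow> l x"
    by blast
  have "compact {0..1::real}" by simp
  moreover have "\<forall>n. f (r n) a \<in> {0..1}" using insert.prems by auto
  ultimately obtain k s where s: "strict_mono (s :: nat \<Rightarrow> nat)" "((\<lambda>n. f (r n) a) \<circ> s) \<longlonglongrightarrow> k"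
    unfolding compact_def by metis
  have "(\<lambda>n. f (r (s n)) x) \<longlonglongrightarrow> (l(a := k)) x" if "x \<in> insert a E" for x
  proof (cases "x = a")
    case True
    then show ?thesis using s(2) by (simp add: o_def)
  next
    case False
    then show ?thesis using LIMSEQ_subseq_LIMSEQ[OF r(2) s(1), of x] that by (simp add: o_def)
  qed
  moreover have "strict_mono (r \<circ> s)" using r(1) s(1) by (rule strict_mono_o)
  ultimately show ?case
    by (intro exI[of _ "r \<circ> s"] exI[of _ "l(a := k)"]) (auto simp: o_def simp del: fun_upd_apply)
qed

lemma is_stationary_le_1:
  assumes "finite E" "is_stationary E P \<nu>"
  shows "0 \<le> \<nu> x" "\<nu> x \<le> 1"
proof -
  show "0 \<le> \<nu> x" using assms(2) unfolding is_stationary_def by (cases "x \<in> E") auto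
  have "\<nu> x \<le> sum \<nu> E" if "x \<in> E"
    using assms that by (intro member_le_sum) (auto simp: is_stationary_def)
  then show "\<nu> x \<le> 1" using assms(2) unfolding is_stationary_def by (cases "x \<in> E") auto
qed

text \<open>Limit points of the Cesaro averages of the rows of the powers are stationary.\<close>

lemma exists_stationary:
  assumes "finite E" "E \<noteq> {}" "stochastic E P"
  shows "\<exists>\<nu>. is_stationary E P \<nu>"
proof -
  obtain x where x: "x \<in> E" using assms(2) by auto
  define a where "a N y = (\<Sum>n<Suc N. nstep E P n x y) / real (Suc N)" for N y
  have a_sum: "(\<Sum>y\<in>E. a N y) = 1" for N
    unfolding a_def sum_divide_distrib[symmetric]
    by (subst sum.swap) (simp add: nstep_row_sum[OF assms(1,3) x] del: sum.lessThan_Suc)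
  have a0: "0 \<le> a N y" if "y \<in> E" for N y
    unfolding a_def using that by (intro divide_nonneg_nonneg sum_nonneg nstep_nonneg assms x) auto
  have nstep1: "nstep E P n x y \<le> 1" if "y \<in> E" for n y
    using member_le_sum[of y E "nstep E P n x"] that nstep_row_sum[OF assms(1,3) x, of n]
      nstep_nonneg[OF assms(3) x] assms(1) by auto
  have a1: "a N y \<le> 1" if "y \<in> E" for N y
    using member_le_sum[of y E "a N"] that a_sum[of N] a0 assms(1) by auto
  obtain r l where r: "strict_mono (r :: nat \<Rightarrow> nat)" and l: "\<And>y. y \<in> E \<Longrightarrow> (\<lambda>n. a (r n) y) \<longlonglongrightarrow> l y"
    using finite_pointwise_convergent_subsequence[of E a] assms(1) a0 a1 by blast
  \<comment> \<open>The averages are invariant up to a telescoping remainder: two numbers in [0, 1],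
    divided by the number of summands.\<close>
  have shift: "(\<Sum>z\<in>E. a N z * P z y) - a N y = (nstep E P (Suc N) x y - nstep E P 0 x y) / real (Suc N)"
    if "y \<in> E" for N y
  proof -
    have "(\<Sum>z\<in>E. a N z * P z y) = (\<Sum>n<Suc N. \<Sum>z\<in>E. nstep E P n x z * P z y) / real (Suc N)"
      unfolding a_def
      by (subst sum.swap) (simp add: sum_divide_distrib sum_distrib_right del: sum.lessThan_Suc)
    also have "\<dots> = (\<Sum>n<Suc N. nstep E P (Suc n) x y) / real (Suc N)"
      using nstep_Suc_right[OF assms(1) x that, of P] by (simp del: nstep.simps sum.lessThan_Suc)
    finally have "(\<Sum>z\<in>E. a N z * P z y) - a N y
        = (\<Sum>n<Suc N. nstep E P (Suc n) x y - nstep E P n x y) / real (Suc N)"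
      unfolding a_def by (simp add: sum_subtractf diff_divide_distrib del: nstep.simps sum.lessThan_Suc)
    then show ?thesis by (simp only: sum_lessThan_telescope[of "\<lambda>n. nstep E P n x y"])
  qed
  have stat: "(\<Sum>z\<in>E. l z * P z y) = l y" if y: "y \<in> E" for y
  proof -
    have "(\<lambda>n. (\<Sum>z\<in>E. a (r n) z * P z y) - a (r n) y) \<longlonglongrightarrow> (\<Sum>z\<in>E. l z * P z y) - l y"
      using l y by (intro tendsto_intros) auto
    moreover have "(\<lambda>n. (\<Sum>z\<in>E. a (r n) z * P z y) - a (r n) y) \<longlonglongrightarrow> 0"
    proof (rule tendsto_rabs_zero_cancel, rule tendsto_sandwich[of "\<lambda>_. 0"])
      have "(\<lambda>n. inverse (real (Suc (r n)))) \<longlonglongrightarrow> 0"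
        using LIMSEQ_subseq_LIMSEQ[OF LIMSEQ_inverse_real_of_nat r] by (simp add: o_def)
      then show "(\<lambda>n. inverse (real (Suc (r n)))) \<longlonglongrightarrow> 0" .
      show "\<forall>\<^sub>F n in sequentially. \<bar>(\<Sum>z\<in>E. a (r n) z * P z y) - a (r n) y\<bar> \<le> inverse (real (Suc (r n)))"
      proof (intro always_eventually allI)
        fix n
        have "\<bar>nstep E P (Suc (r n)) x y - nstep E P 0 x y\<bar> \<le> 1"
          using nstep1[OF y] nstep_nonneg[OF assms(3) x y] by (smt (verit, best))
        then show "\<bar>(\<Sum>z\<in>E. a (r n) z * P z y) - a (r n) y\<bar> \<le> inverse (real (Suc (r n)))"
          unfolding shift[OF y] by (simp add: abs_divide inverse_eq_divide divide_right_mono del: nstep.simps)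
      qed
    qed auto
    ultimately show ?thesis using LIMSEQ_unique by fastforce
  qed
  have "0 \<le> l y" if "y \<in> E" for y
    using l[OF that] a0[OF that] by (intro LIMSEQ_le_const[of _ "l y"]) auto
  moreover have "(\<Sum>y\<in>E. l y) = 1"
  proof -
    have "(\<lambda>n. \<Sum>y\<in>E. a (r n) y) \<longlonglongrightarrow> (\<Sum>y\<in>E. l y)"
      using l by (intro tendsto_sum) auto
    then show ?thesis by (simp add: a_sum LIMSEQ_const_iff)
  qed
  ultimately have "is_stationary E P (\<lambda>y. if y \<in> E then l y else 0)"
    using stat by (auto simp: is_stationary_def)
  then show ?thesis by blast
qed

text \<open>The support of a nonnegative invariant vector is a closed set. No normalisation is
  assumed, because the uniqueness proof applies this to a difference
  \<open>\<mu> - c * \<nu>\<close>.\<close>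

lemma invariant_positive:
  assumes "finite E" "stochastic E P" "irreducible_chain E P"
    and nn: "\<And>x. x \<in> E \<Longrightarrow> 0 \<le> \<nu> x" and inv: "\<And>y. y \<in> E \<Longrightarrow> (\<Sum>x\<in>E. \<nu> x * P x y) = \<nu> y"
    and x: "x \<in> E" "\<nu> x \<noteq> 0" and y: "y \<in> E"
  shows "0 < \<nu> y"
proof -
  define C where "C = {z \<in> E. 0 < \<nu> z}"
  have "closed_set E P C"
    unfolding closed_set_def
  proof (intro conjI ballI impI)
    fix z w assume z: "z \<in> C" and w: "w \<in> E" "0 < P z w"
    then have "0 < \<nu> z * P z w" by (simp add: C_def)
    also have "\<dots> \<le> (\<Sum>z\<in>E. \<nu> z * P z w)"
      using z w assms(1,2) nn by (intro member_le_sum[of z E "\<lambda>z. \<nu> z * P z w"])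
        (auto simp: C_def stochastic_nonneg)
    finally show "w \<in> C" using w inv by (simp add: C_def)
  qed (auto simp: C_def)
  moreover have "x \<in> C" using x nn[of x] by (simp add: C_def)
  ultimately have "C = E" using assms(3) irreducible_iff_closed_set[OF assms(1,2)] by auto
  with y show ?thesis by (auto simp: C_def)
qed

lemma is_stationary_pos:
  assumes "finite E" "stochastic E P" "irreducible_chain E P" "is_stationary E P \<nu>" "y \<in> E"
  shows "0 < \<nu> y"
proof -
  obtain x where "x \<in> E" "\<nu> x \<noteq> 0"
    using assms(4) unfolding is_stationary_def by (metis sum.neutral zero_neq_one)
  with invariant_positive[OF assms(1-3), of \<nu>] assms(4,5) show ?thesis
    by (auto simp: is_stationary_def)
qed

text \<open>With \<open>c\<close> the smallest ratio of the two, \<open>\<mu> - c * \<nu>\<close> is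
  nonnegative, invariant and zero at a minimising state, so it vanishes on \<open>E\<close>; the
  normalisation gives \<open>c = 1\<close>. Off \<open>E\<close> both functions are 0 by
  convention.\<close>

lemma is_stationary_unique:
  assumes "finite E" "stochastic E P" "irreducible_chain E P"
    and \<nu>: "is_stationary E P \<nu>" and \<mu>: "is_stationary E P \<mu>"
  shows "\<mu> = \<nu>"
proof -
  have "E \<noteq> {}" using \<nu> by (auto simp: is_stationary_def)
  define c where "c = Min ((\<lambda>x. \<mu> x / \<nu> x) ` E)"
  have pos: "0 < \<nu> x" if "x \<in> E" for x
    using is_stationary_pos[OF assms(1-4) that] .
  have c: "c * \<nu> x \<le> \<mu> x" if "x \<in> E" for x
  proof -
    have "c \<le> \<mu> x / \<nu> x" unfolding c_def using that assms(1) by auto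
    then show ?thesis using pos[OF that] by (simp add: pos_le_divide_eq)
  qed
  have "c \<in> (\<lambda>x. \<mu> x / \<nu> x) ` E"
    unfolding c_def using assms(1) \<open>E \<noteq> {}\<close> by (intro Min_in) auto
  then obtain z where z: "z \<in> E" "c = \<mu> z / \<nu> z" by auto
  then have z0: "\<mu> z - c * \<nu> z = 0" using pos[of z] by simp
  have eq: "\<mu> x = c * \<nu> x" if x: "x \<in> E" for x
  proof (rule ccontr)
    assume "\<mu> x \<noteq> c * \<nu> x"
    have inv: "(\<Sum>x\<in>E. (\<mu> x - c * \<nu> x) * P x y) = \<mu> y - c * \<nu> y" if "y \<in> E" for y
    proof -
      have "(\<Sum>x\<in>E. (\<mu> x - c * \<nu> x) * P x y) = (\<Sum>x\<in>E. \<mu> x * P x y) - c * (\<Sum>x\<in>E. \<nu> x * P x y)"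
        by (simp add: algebra_simps sum_subtractf sum_distrib_left)
      then show ?thesis using \<mu> \<nu> that by (simp add: is_stationary_def)
    qed
    have "0 < \<mu> z - c * \<nu> z"
      using invariant_positive[OF assms(1-3), of "\<lambda>x. \<mu> x - c * \<nu> x", OF _ inv x _ z(1)]
        c \<open>\<mu> x \<noteq> c * \<nu> x\<close> by auto
    with z0 show False by simp
  qed
  have "1 = (\<Sum>x\<in>E. \<mu> x)" using \<mu> by (simp add: is_stationary_def)
  also have "\<dots> = c * (\<Sum>x\<in>E. \<nu> x)" using eq by (simp add: sum_distrib_left)
  also have "\<dots> = c" using \<nu> by (simp add: is_stationary_def)
  finally show ?thesis
    using eq \<mu> \<nu> by (intro ext) (metis is_stationary_def mult_1)
qed

lemma is_stationary_stationary_dist: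
  assumes "finite E" "E \<noteq> {}" "stochastic E P" "irreducible_chain E P"
  shows "is_stationary E P (stationary_dist E P)"
  unfolding stationary_dist_def
  by (rule theI'[of "is_stationary E P"]) (use exists_stationary[OF assms(1-3)] is_stationary_unique[OF assms(1,3,4)] in blast)

text \<open>A failure would persist along a sequence of parameters tending to 0, with stationary
  \<open>\<mu>\<close> staying away from \<open>\<nu>\<close>. A convergent subsequence of these
  \<open>\<mu>\<close> has a limit stationary for \<open>P\<close>, which can only be
  \<open>\<nu>\<close>. The claim is about every \<open>\<mu>\<close>, as nothing forces
  \<open>Q \<epsilon>\<close> to have just one.\<close>

lemma eventually_stationary_close:
  fixes Q :: "real \<Rightarrow> 's \<Rightarrow> 's \<Rightarrow> real"
  assumes "finite E" "stochastic E P" "irreducible_chain E P" "is_stationary E P \<nu>"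
    and Q: "\<And>x y. x \<in> E \<Longrightarrow> y \<in> E \<Longrightarrow> ((\<lambda>\<epsilon>. Q \<epsilon> x y) \<longlongrightarrow> P x y) (at_right 0)"
    and "0 < \<delta>"
  shows "\<forall>\<^sub>F \<epsilon> in at_right 0. \<forall>\<mu>. is_stationary E (Q \<epsilon>) \<mu> \<longrightarrow> (\<forall>x\<in>E. \<bar>\<mu> x - \<nu> x\<bar> < \<delta>)"
    (is "\<forall>\<^sub>F \<epsilon> in _. ?A \<epsilon>")
proof (rule sequentially_imp_eventually_at_right[of 0 1], simp, rule ccontr)
  fix f :: "nat \<Rightarrow> real" assume f: "\<And>n. 0 < f n" "f \<longlonglongrightarrow> 0"
  assume "\<not> (\<forall>\<^sub>F n in sequentially. ?A (f n))"
  then have "\<exists>\<^sub>F n in sequentially. \<not> ?A (f n)" by (simp only: not_eventually)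
  then have "infinite {n. \<not> ?A (f n)}"
    unfolding frequently_cofinite[symmetric] cofinite_eq_sequentially .
  then obtain s :: "nat \<Rightarrow> nat" where s: "strict_mono s" "\<And>n. \<not> ?A (f (s n))"
    using infinite_enumerate[of "{n. \<not> ?A (f n)}"] by blast
  then have "\<forall>n. \<exists>\<mu>. is_stationary E (Q (f (s n))) \<mu> \<and> \<not> (\<forall>x\<in>E. \<bar>\<mu> x - \<nu> x\<bar> < \<delta>)"
    by blast
  then obtain \<mu> where \<mu>: "\<And>n. is_stationary E (Q (f (s n))) (\<mu> n)"
      "\<And>n. \<not> (\<forall>x\<in>E. \<bar>\<mu> n x - \<nu> x\<bar> < \<delta>)"
    by metis
  obtain r l where r: "strict_mono (r :: nat \<Rightarrow> nat)" and l: "\<And>x. x \<in> E \<Longrightarrow> (\<lambda>n. \<mu> (r n) x) \<longlonglongrightarrow> l x"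
    using finite_pointwise_convergent_subsequence[of E \<mu>] assms(1) is_stationary_le_1[OF assms(1) \<mu>(1)]
    by blast
  have fsr: "filterlim (\<lambda>n. f (s (r n))) (at_right 0) sequentially"
  proof -
    have "(\<lambda>n. f (s (r n))) \<longlonglongrightarrow> 0"
      using LIMSEQ_subseq_LIMSEQ[OF f(2) strict_mono_o[OF s(1) r]] by (simp add: o_def)
    then show ?thesis
      using f(1) f(1)[THEN less_imp_neq, THEN not_sym] by (simp add: filterlim_at)
  qed
  have QL: "(\<lambda>n. Q (f (s (r n))) x y) \<longlonglongrightarrow> P x y" if "x \<in> E" "y \<in> E" for x y
    using filterlim_compose[OF Q[OF that] fsr] .
  define l' where "l' x = (if x \<in> E then l x else 0)" for x
  have "is_stationary E P l'"
    unfolding is_stationary_def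
  proof (intro conjI ballI allI impI)
    show "0 \<le> l' x" if "x \<in> E" for x
      using l[OF that] is_stationary_le_1[OF assms(1) \<mu>(1)] that
      by (auto simp: l'_def intro: LIMSEQ_le_const)
    have "(\<lambda>n. \<Sum>x\<in>E. \<mu> (r n) x) \<longlonglongrightarrow> (\<Sum>x\<in>E. l x)"
      using l by (intro tendsto_sum) auto
    then show "(\<Sum>x\<in>E. l' x) = 1"
      using \<mu>(1) by (simp add: l'_def is_stationary_def LIMSEQ_const_iff)
    show "(\<Sum>x\<in>E. l' x * P x y) = l' y" if y: "y \<in> E" for y
    proof -
      have "(\<lambda>n. \<Sum>x\<in>E. \<mu> (r n) x * Q (f (s (r n))) x y) \<longlonglongrightarrow> (\<Sum>x\<in>E. l x * P x y)"
        using l QL y by (intro tendsto_intros) auto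
      moreover have "(\<Sum>x\<in>E. \<mu> (r n) x * Q (f (s (r n))) x y) = \<mu> (r n) y" for n
        using \<mu>(1) y by (simp add: is_stationary_def)
      ultimately have "(\<Sum>x\<in>E. l x * P x y) = l y"
        using l[OF y] LIMSEQ_unique by simp
      then show ?thesis using y by (simp add: l'_def)
    qed
  qed (simp add: l'_def)
  then have "l' = \<nu>" by (rule is_stationary_unique[OF assms(1-4)])
  then have "l x = \<nu> x" if "x \<in> E" for x using that by (metis l'_def)
  then have "\<forall>\<^sub>F n in sequentially. \<forall>x\<in>E. \<bar>\<mu> (r n) x - \<nu> x\<bar> < \<delta>"
    using l assms(6) tendstoD[OF l assms(6)]
    by (intro eventually_ball_finite assms(1)) (auto simp: dist_real_def)
  then show False using \<mu>(2) by (auto dest!: eventually_happens)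
qed

text \<open>Since no mass leaves \<open>E\<close>, the restricted matrix is again stochastic, and a
  set closed inside \<open>E\<close> is closed in \<open>S\<close>. The latter gives irreducibility
  on \<open>E\<close>: any state of such a set reaches the whole class.\<close>

lemma essential_class_props:
  assumes "finite S" "stochastic S P" "essential_class S P E"
  shows "E \<subseteq> S" "E \<noteq> {}" "closed_set S P E" "stochastic E P" "irreducible_chain E P"
    "\<And>x y. x \<in> E \<Longrightarrow> y \<in> S - E \<Longrightarrow> P x y = 0"
proof -
  obtain x where x: "x \<in> S" "E = communicating S P `` {x}"
    using assms(3) by (auto simp: essential_class_def quotient_def)
  show ES: "E \<subseteq> S" using x by (auto simp: communicating_def)
  show ne: "E \<noteq> {}" using x leads_to_refl[of S P x] by (auto simp: communicating_def)
  have step: "leads_to S P y z" if "y \<in> S" "z \<in> S" "0 < P y z" for y z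
    using closed_set_reachable[OF assms(1,2) that(1)] that leads_to_refl[of S P y]
    by (auto simp: closed_set_def)
  show cl: "closed_set S P E"
    unfolding closed_set_def using ES step assms(3) by (auto simp: essential_class_def)
  show z: "P x y = 0" if "x \<in> E" "y \<in> S - E" for x y
    using cl that stochastic_nonneg[OF assms(2), of x y] ES by (fastforce simp: closed_set_def)
  have "(\<Sum>z\<in>E. P y z) = 1" if "y \<in> E" for y
  proof -
    have "(\<Sum>z\<in>S. P y z) = (\<Sum>z\<in>E. P y z)"
      using assms(1) ES z that by (intro sum.mono_neutral_right) auto
    then show ?thesis using ES that stochastic_sum[OF assms(2), of y] by auto
  qed
  then show st: "stochastic E P"
    using ES assms(2) unfolding stochastic_def by blast
  have fin: "finite E" using ES assms(1) by (rule finite_subset)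
  show "irreducible_chain E P"
    unfolding irreducible_iff_closed_set[OF fin st]
  proof (intro allI impI)
    fix C assume C: "closed_set E P C" "C \<noteq> {}"
    then have C': "closed_set S P C" using ES cl by (auto simp: closed_set_def)
    obtain w where w: "w \<in> C" using C by auto
    have "leads_to S P w y" if "y \<in> E" for y
      using that w C(1) x leads_to_trans[OF assms(1,2), of w x y]
      by (auto simp: closed_set_def communicating_def)
    then show "C = E"
      using leads_to_closed_set[OF assms(2) C' w] C(1) by (auto simp: closed_set_def)
  qed
qed

section \<open>Harmonic functions\<close>

text \<open>Paths stay in \<open>S\<close>, so the event is empty. This covers the case of an empty
  boundary, where the Dirichlet equations admit all constants and determine nothing.\<close>

lemma prob_hits_before_no_target:
  assumes "finite S" "stochastic S P" "x \<in> S" "B \<inter> S = {}"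
  shows "prob_hits_before S P x B A = 0"
proof -
  interpret Ionescu_Tulcea "path_kernel S P x" "\<lambda>_. count_space S"
    by (rule Ionescu_Tulcea_path_kernel[OF assms(1-3)])
  have "space (path_measure S P x) = space (PiM UNIV (\<lambda>_. count_space S))"
    by (simp add: path_measure_def)
  then have "{\<omega> \<in> space (path_measure S P x). hitting_time B \<omega> < hitting_time A \<omega>} = {}"
    using assms(4) by (auto simp: hitting_time_less_iff space_PiM PiE_iff)
  then show ?thesis by (simp only: prob_hits_before_def measure_empty)
qed

definition harmonic_off :: "'s set \<Rightarrow> ('s \<Rightarrow> 's \<Rightarrow> real) \<Rightarrow> 's set \<Rightarrow> ('s \<Rightarrow> real) \<Rightarrow> bool" where
  "harmonic_off S P D f \<longleftrightarrow> (\<forall>x\<in>S - D. f x = (\<Sum>y\<in>S. P x y * f y))"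

lemma harmonic_offD: "harmonic_off S P D f \<Longrightarrow> x \<in> S \<Longrightarrow> x \<notin> D \<Longrightarrow> f x = (\<Sum>y\<in>S. P x y * f y)"
  by (simp add: harmonic_off_def)

lemma harmonic_off_mono: "harmonic_off S P D f \<Longrightarrow> D \<subseteq> D' \<Longrightarrow> harmonic_off S P D' f"
  by (auto simp: harmonic_off_def)

lemma harmonic_off_add_cmult:
  assumes "harmonic_off S P D f" "harmonic_off S P D g"
  shows "harmonic_off S P D (\<lambda>x. f x + c * g x)"
  unfolding harmonic_off_def
proof
  fix x assume "x \<in> S - D"
  then have "f x + c * g x = (\<Sum>y\<in>S. P x y * f y) + c * (\<Sum>y\<in>S. P x y * g y)"
    using assms by (simp add: harmonic_off_def)
  also have "\<dots> = (\<Sum>y\<in>S. P x y * (f y + c * g y))"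
    by (simp add: distrib_left sum.distrib sum_distrib_left mult.left_commute)
  finally show "f x + c * g x = (\<Sum>y\<in>S. P x y * (f y + c * g y))" .
qed

text \<open>The minimum principle for the difference, which is written as
  \<open>g x + (- 1) * f x\<close> to match \<open>harmonic_off_add_cmult\<close>. Applied in both
  directions it gives uniqueness for given boundary values.\<close>

lemma harmonic_off_le:
  assumes "finite S" "stochastic S P" "irreducible_chain S P" "D \<inter> S \<noteq> {}"
    and "harmonic_off S P D f" "harmonic_off S P D g"
    and "\<And>x. x \<in> S \<Longrightarrow> x \<in> D \<Longrightarrow> f x \<le> g x" and "x \<in> S"
  shows "f x \<le> g x"
proof -
  have h: "harmonic_off S P D (\<lambda>x. g x + (- 1) * f x)"
    by (rule harmonic_off_add_cmult) fact+
  have "0 \<le> g x + (- 1) * f x"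
  proof (rule minimum_principle[OF assms(1-4) _ _ assms(8), of "\<lambda>x. g x + (- 1) * f x"])
    show "0 \<le> g y + (- 1) * f y" if "y \<in> S" "y \<in> D" for y
      using assms(7)[OF that] by simp
    show "(\<Sum>z\<in>S. P y z * (g z + (- 1) * f z)) \<le> g y + (- 1) * f y" if "y \<in> S" "y \<notin> D" for y
      using harmonic_offD[OF h that] by (rule eq_refl[OF sym])
  qed
  then show ?thesis by simp
qed

lemma harmonic_off_prob_hits_before:
  assumes "finite S" "stochastic S P"
  shows "harmonic_off S P (A \<union> B) (\<lambda>x. prob_hits_before S P x B A)"
  unfolding harmonic_off_def using prob_hits_before_dirichlet(3)[OF assms] by simp

text \<open>
  Setting \<open>prob_hits_before S P\<close> to zero on the zero set of \<open>prob_hits_before S Q\<close> leaves a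
  superharmonic function with the same boundary values.
\<close>

lemma prob_hits_before_zero_mono:
  assumes "finite S" "stochastic S P" "irreducible_chain S P" "stochastic S Q"
    and PQ: "\<And>x y. x \<in> S \<Longrightarrow> y \<in> S \<Longrightarrow> 0 < P x y \<Longrightarrow> 0 < Q x y"
    and x: "x \<in> S" and Qx: "prob_hits_before S Q x B A = 0"
  shows "prob_hits_before S P x B A = 0"
proof (cases "(A \<union> B) \<inter> S = {}")
  case True
  then show ?thesis using prob_hits_before_no_target[OF assms(1,2) x] by blast
next
  case False
  let ?h = "\<lambda>x. prob_hits_before S P x B A"
  define U where "U = {y \<in> S. prob_hits_before S Q y B A = 0}"
  define f where "f y = (if y \<in> U then 0 else ?h y)" for y
  have fle: "f y \<le> ?h y" for y by (simp add: f_def prob_hits_before_nonneg)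
  \<comment> \<open>Off the boundary, a vanishing average of nonnegative values vanishes at every
    \<open>Q\<close>-successor, and every \<open>P\<close>-edge is a \<open>Q\<close>-edge.\<close>
  have U: "z \<in> U" if "y \<in> U" "y \<notin> A \<union> B" "z \<in> S" "0 < P y z" for y z
  proof -
    have y: "y \<in> S" using that by (simp add: U_def)
    have "0 = (\<Sum>w\<in>S. Q y w * prob_hits_before S Q w B A)"
      using that prob_hits_before_dirichlet(3)[OF assms(1,4) y, of A B] by (simp add: U_def)
    moreover have nn: "0 \<le> Q y w * prob_hits_before S Q w B A" if "w \<in> S" for w
      using stochastic_nonneg[OF assms(4) y that] prob_hits_before_nonneg by (intro mult_nonneg_nonneg)
    ultimately have "Q y z * prob_hits_before S Q z B A = 0"
      using that(3) assms(1) sum_nonneg_eq_0_iff[of S "\<lambda>w. Q y w * prob_hits_before S Q w B A"]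
      by auto
    moreover have "0 < Q y z" using PQ y that by blast
    ultimately show ?thesis using that by (simp add: U_def)
  qed
  have "0 \<le> f y - ?h y" if "y \<in> S" for y
  proof (rule minimum_principle[OF assms(1-3) False _ _ that, of "\<lambda>y. f y - ?h y"])
    fix y assume y: "y \<in> S" "y \<in> A \<union> B"
    show "0 \<le> f y - ?h y"
    proof (cases "y \<in> U")
      case True
      then have "\<not> (y \<in> B \<and> y \<notin> A)"
        using prob_hits_before_dirichlet(2)[OF assms(1,4) y(1), of B A] by (auto simp: U_def)
      then show ?thesis
        using y prob_hits_before_dirichlet(1)[OF assms(1,2) y(1), of A B] True by (auto simp: f_def)
    qed (simp add: f_def)
  next
    fix y assume y: "y \<in> S" "y \<notin> A \<union> B"
    have "(\<Sum>z\<in>S. P y z * (f z - ?h z)) = (\<Sum>z\<in>S. P y z * f z) - ?h y"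
      using prob_hits_before_dirichlet(3)[OF assms(1,2) y(1), of A B] y
      by (simp add: right_diff_distrib sum_subtractf)
    also have "(\<Sum>z\<in>S. P y z * f z) \<le> f y"
    proof (cases "y \<in> U")
      case True
      have "P y z * f z = 0" if "z \<in> S" for z
        using U[OF True y(2) that] stochastic_nonneg[OF assms(2) y(1) that]
        by (cases "P y z = 0") (auto simp: f_def)
      then have "(\<Sum>z\<in>S. P y z * f z) = 0" by (intro sum.neutral) blast
      then show ?thesis using True by (simp add: f_def)
    next
      case False
      have "(\<Sum>z\<in>S. P y z * f z) \<le> (\<Sum>z\<in>S. P y z * ?h z)"
        using stochastic_nonneg[OF assms(2) y(1)] fle by (intro sum_mono mult_left_mono) auto
      also have "\<dots> = f y"
        using prob_hits_before_dirichlet(3)[OF assms(1,2) y(1), of A B] y False by (simp add: f_def)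
      finally show ?thesis .
    qed
    finally show "(\<Sum>z\<in>S. P y z * (f z - ?h z)) \<le> f y - ?h y" by simp
  qed
  moreover have "x \<in> U" using x Qx by (simp add: U_def)
  ultimately show ?thesis
    using x prob_hits_before_nonneg[of S P x B A] by (force simp: f_def)
qed

section \<open>The zero-or-positive dichotomy and criteria for asymptotic equivalence\<close>

lemma zero_or_positive_iff_eventually:
  "zero_or_positive a \<longleftrightarrow> (\<forall>\<epsilon>>0. a \<epsilon> = 0) \<or> (\<forall>\<^sub>F \<epsilon> in at_right 0. 0 < a \<epsilon>)"
  unfolding zero_or_positive_def eventually_at_right_field by blast

text \<open>Whether the probability is positive depends only on which entries are positive,
  monotonically. If it is nonzero at one parameter \<open>e\<close>, then each edge present at
  \<open>e\<close> is present for all small \<epsilon>, so the probability is positive there as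
  well.\<close>

lemma zero_or_positive_prob_hits_before:
  assumes "finite S" and st: "\<And>\<epsilon>. 0 < \<epsilon> \<Longrightarrow> stochastic S (q \<epsilon>)"
    and irr: "\<And>\<epsilon>. 0 < \<epsilon> \<Longrightarrow> irreducible_chain S (q \<epsilon>)"
    and zp: "\<And>x y. x \<in> S \<Longrightarrow> y \<in> S \<Longrightarrow> zero_or_positive (\<lambda>\<epsilon>. q \<epsilon> x y)"
    and x: "x \<in> S"
  shows "zero_or_positive (\<lambda>\<epsilon>. prob_hits_before S (q \<epsilon>) x B A)"
proof (cases "\<forall>\<epsilon>>0. prob_hits_before S (q \<epsilon>) x B A = 0")
  case False
  then obtain e where e: "0 < e" "prob_hits_before S (q e) x B A \<noteq> 0" by auto
  have "\<forall>\<^sub>F \<epsilon> in at_right 0. 0 < q e y z \<longrightarrow> 0 < q \<epsilon> y z" if "y \<in> S" "z \<in> S" for y z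
    using zp[OF that] e(1) unfolding zero_or_positive_iff_eventually
    by (auto elim: eventually_mono)
  then have "\<forall>\<^sub>F \<epsilon> in at_right 0. \<forall>y\<in>S. \<forall>z\<in>S. 0 < q e y z \<longrightarrow> 0 < q \<epsilon> y z"
    by (intro eventually_ball_finite assms(1) ballI)
  then have "\<forall>\<^sub>F \<epsilon> in at_right 0. 0 < prob_hits_before S (q \<epsilon>) x B A"
    using eventually_at_right_less[of 0]
  proof eventually_elim
    case (elim \<epsilon>)
    then have "prob_hits_before S (q \<epsilon>) x B A \<noteq> 0"
      using prob_hits_before_zero_mono[OF assms(1) st irr st _ x, of e \<epsilon>] e by blast
    then show ?case using prob_hits_before_nonneg[of S "q \<epsilon>" x B A] by simp
  qed
  then show ?thesis by (simp add: zero_or_positive_iff_eventually)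
qed (simp add: zero_or_positive_def)

text \<open>The hypothesis is free of quotients, so it also covers parameters at which both
  functions vanish: either being 0 forces the other to be 0, in agreement with the convention that
  reads 0 / 0 as 1.\<close>

lemma asymp_equiv_atI_ratio:
  fixes a b :: "real \<Rightarrow> real"
  assumes nn: "\<And>\<epsilon>. 0 \<le> a \<epsilon>" "\<And>\<epsilon>. 0 \<le> b \<epsilon>"
    and *: "\<And>\<delta>. 0 < \<delta> \<Longrightarrow> \<delta> < 1 \<Longrightarrow>
      \<forall>\<^sub>F \<epsilon> in F. (1 - \<delta>) * b \<epsilon> \<le> (1 + \<delta>) * a \<epsilon> \<and> (1 - \<delta>) * a \<epsilon> \<le> (1 + \<delta>) * b \<epsilon>"
  shows "a \<sim>[F] b"
proof (rule asymp_equivI, rule tendstoI)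
  fix e :: real assume e: "0 < e"
  \<comment> \<open>For \<open>u = a / b\<close> the hypotheses give
    \<open>\<bar>u - 1\<bar> \<le> \<delta> * (1 + u)\<close>. As \<open>\<delta> \<le> 1/2\<close>
    yields \<open>u \<le> 3\<close>, this is at most \<open>4 * \<delta>\<close>, strictly below
    \<open>e\<close>.\<close>
  define \<delta> where "\<delta> = min (1/2) (e/5)"
  have \<delta>: "0 < \<delta>" "\<delta> \<le> 1/2" "5 * \<delta> \<le> e" using e by (auto simp: \<delta>_def)
  have "\<forall>\<^sub>F \<epsilon> in F. (1 - \<delta>) * b \<epsilon> \<le> (1 + \<delta>) * a \<epsilon> \<and> (1 - \<delta>) * a \<epsilon> \<le> (1 + \<delta>) * b \<epsilon>"
    using \<delta> by (intro *) auto
  then show "\<forall>\<^sub>F \<epsilon> in F. dist (if a \<epsilon> = 0 \<and> b \<epsilon> = 0 then 1 else a \<epsilon> / b \<epsilon>) 1 < e"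
  proof eventually_elim
    case (elim \<epsilon>)
    show ?case
    proof (cases "b \<epsilon> = 0")
      case True
      then have "(1 - \<delta>) * a \<epsilon> \<le> 0" using elim by simp
      then have "a \<epsilon> = 0" using nn(1)[of \<epsilon>] \<delta> by (simp add: mult_le_0_iff)
      then show ?thesis using True e by simp
    next
      case False
      then have b: "0 < b \<epsilon>" using nn(2)[of \<epsilon>] by simp
      define u where "u = a \<epsilon> / b \<epsilon>"
      have u: "a \<epsilon> = u * b \<epsilon>" "0 \<le> u" using b nn(1)[of \<epsilon>] by (auto simp: u_def)
      have "(1 - \<delta>) * b \<epsilon> \<le> ((1 + \<delta>) * u) * b \<epsilon>" "((1 - \<delta>) * u) * b \<epsilon> \<le> (1 + \<delta>) * b \<epsilon>"
        using elim u by (simp_all add: mult_ac)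
      then have u1: "1 - \<delta> \<le> (1 + \<delta>) * u" "(1 - \<delta>) * u \<le> 1 + \<delta>"
        using b by simp_all
      have "(1 - \<delta>) * u \<ge> (1/2) * u" using \<delta> u by (intro mult_right_mono) auto
      then have "u \<le> 3" using u1(2) \<delta> by simp
      then have "\<delta> * u \<le> \<delta> * 3" using \<delta> by (intro mult_left_mono) auto
      with u1 \<delta> have "\<bar>u - 1\<bar> < e"
        unfolding left_diff_distrib distrib_right abs_less_iff by linarith
      then show ?thesis using False by (simp add: u_def dist_real_def)
    qed
  qed
qed

text \<open>Equivalent functions eventually have the same zeros. Hence if \<open>b\<close> is
  identically 0, then \<open>a\<close> cannot be eventually positive and the dichotomy makes it
  identically 0; if \<open>b\<close> is eventually positive, the convention for 0 / 0 drops out of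
  the limit.\<close>

lemma asymptotic_toI:
  assumes "a \<sim>[at_right 0] b" "zero_or_positive a" "zero_or_positive b"
  shows "asymptotic_to a b"
proof -
  have lim: "((\<lambda>x. if a x = 0 \<and> b x = 0 then 1 else a x / b x) \<longlongrightarrow> 1) (at_right 0)"
    using assms(1) by (rule asymp_equivD)
  have ev0: "\<forall>\<^sub>F x in at_right 0. f x = 0" if "\<forall>x>0. f x = 0" for f :: "real \<Rightarrow> real"
    using eventually_at_right_less[of 0] by eventually_elim (use that in auto)
  have ab: "\<forall>\<^sub>F x in at_right 0. (a x = 0) = (b x = 0)"
    using asymp_equiv_eventually_zeros[OF assms(1)] .
  have nt: "\<not> (\<forall>\<^sub>F x in at_right (0::real). False)" by simp
  show ?thesis
  proof (cases "\<forall>x>0. b x = 0")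
    case True
    have "\<not> (\<forall>\<^sub>F x in at_right 0. 0 < a x)"
    proof
      assume "\<forall>\<^sub>F x in at_right 0. 0 < a x"
      with ab ev0[OF True] have "\<forall>\<^sub>F x in at_right (0::real). False" by eventually_elim auto
      with nt show False by blast
    qed
    then have "\<forall>x>0. a x = 0" using assms(2) by (simp add: zero_or_positive_iff_eventually)
    with True show ?thesis by (simp add: asymptotic_to_def)
  next
    case False
    then have b: "\<exists>\<epsilon>\<^sub>0>0. \<forall>\<epsilon>. 0 < \<epsilon> \<and> \<epsilon> < \<epsilon>\<^sub>0 \<longrightarrow> 0 < b \<epsilon>" and evb: "\<forall>\<^sub>F x in at_right 0. 0 < b x"
      using assms(3) unfolding zero_or_positive_iff_eventually by (auto simp: zero_or_positive_def eventually_at_right_field)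
    have "((\<lambda>x. a x / b x) \<longlongrightarrow> 1) (at_right 0)"
      using lim by (rule Lim_transform_eventually) (use evb in eventually_elim, auto)
    with b show ?thesis by (simp add: asymptotic_to_def)
  qed
qed

section \<open>Hitting probabilities of the lifted chain\<close>

locale lifted_class =
  fixes S E :: "'s set" and p :: "real \<Rightarrow> 's \<Rightarrow> 's \<Rightarrow> real"
  assumes finite_S: "finite S"
    and irr_pert: "irreducibly_perturbed_chain S p"
    and essential: "essential_class S (p 0) E"
    and not_all: "E \<noteq> S"
begin

abbreviation "\<nu> \<equiv> stationary_dist E (p 0)"
abbreviation "S' \<equiv> lifted_space S E"
abbreviation "p' \<equiv> lifted_chain S p E"

lemma stochastic_p: "0 \<le> \<epsilon> \<Longrightarrow> stochastic S (p \<epsilon>)"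
  and irreducible_p: "0 < \<epsilon> \<Longrightarrow> irreducible_chain S (p \<epsilon>)"
  and tendsto_p: "x \<in> S \<Longrightarrow> y \<in> S \<Longrightarrow> ((\<lambda>\<epsilon>. p \<epsilon> x y) \<longlongrightarrow> p 0 x y) (at_right 0)"
  using irr_pert by (auto simp: irreducibly_perturbed_chain_def perturbed_chain_def)

lemmas E_props = essential_class_props[OF finite_S stochastic_p[OF order_refl] essential]

lemma finite_E: "finite E" using E_props(1) finite_S by (rule finite_subset)

lemma p_nonneg: "0 \<le> \<epsilon> \<Longrightarrow> x \<in> S \<Longrightarrow> y \<in> S \<Longrightarrow> 0 \<le> p \<epsilon> x y"
  by (rule stochastic_nonneg[OF stochastic_p])

lemma sum_split_E: "(\<Sum>y\<in>S. f y) = (\<Sum>y\<in>S - E. f y) + (\<Sum>y\<in>E. f y)" for f :: "'s \<Rightarrow> real"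
  using sum.subset_diff[OF E_props(1) finite_S, of f] .

lemma stationary_nu: "is_stationary E (p 0) \<nu>"
  by (rule is_stationary_stationary_dist[OF finite_E E_props(2,4,5)])

lemma nu_pos: "z \<in> E \<Longrightarrow> 0 < \<nu> z"
  by (rule is_stationary_pos[OF finite_E E_props(4,5) stationary_nu])

text \<open>The flow out of \<open>E\<close> under the weights \<open>\<mu>\<close>, integrated
  against \<open>g\<close>. It is left unnormalised: the value at \<open>g = 1\<close> is the total
  flow, which is \<open>lift_Z\<close> for the weights \<open>\<nu>\<close>.\<close>

definition exit_sum :: "real \<Rightarrow> ('s \<Rightarrow> real) \<Rightarrow> ('s \<Rightarrow> real) \<Rightarrow> real" where
  "exit_sum \<epsilon> \<mu> g = (\<Sum>y\<in>S - E. (\<Sum>z\<in>E. \<mu> z * p \<epsilon> z y) * g y)"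

lemma exit_sum_linear: "exit_sum \<epsilon> \<mu> (\<lambda>y. f y + c * g y) = exit_sum \<epsilon> \<mu> f + c * exit_sum \<epsilon> \<mu> g"
  unfolding exit_sum_def
  by (simp add: distrib_left sum.distrib sum_distrib_left[of c] mult.left_commute)

lemma exit_sum_mono:
  assumes "0 < \<epsilon>" "\<And>z. z \<in> E \<Longrightarrow> 0 \<le> \<mu> z" "\<And>y. y \<in> S - E \<Longrightarrow> f y \<le> g y"
  shows "exit_sum \<epsilon> \<mu> f \<le> exit_sum \<epsilon> \<mu> g"
  unfolding exit_sum_def using assms p_nonneg[of \<epsilon>] E_props(1)
  by (intro sum_mono mult_left_mono sum_nonneg mult_nonneg_nonneg) auto

text \<open>Transfers a relative bound on weights to exit sums; constants on both sides allow either
  of \<open>\<mu>\<close> and \<open>\<nu>\<close> to carry the factor.\<close>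

lemma exit_sum_cmult_mono:
  assumes "0 < \<epsilon>" "\<And>z. z \<in> E \<Longrightarrow> a * \<mu> z \<le> b * \<rho> z" "\<And>y. y \<in> S - E \<Longrightarrow> 0 \<le> g y"
  shows "a * exit_sum \<epsilon> \<mu> g \<le> b * exit_sum \<epsilon> \<rho> g"
proof -
  have eq: "c * exit_sum \<epsilon> \<mu> g = exit_sum \<epsilon> (\<lambda>z. c * \<mu> z) g" for c \<mu>
    unfolding exit_sum_def by (simp add: sum_distrib_left sum_distrib_right mult_ac)
  show ?thesis
    unfolding eq unfolding exit_sum_def using assms p_nonneg[of \<epsilon>] E_props(1)
    by (intro sum_mono mult_right_mono) auto
qed

lemma lift_Z_eq: "lift_Z S p E \<epsilon> = exit_sum \<epsilon> \<nu> (\<lambda>_. 1)"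
  unfolding lift_Z_def exit_sum_def by (simp add: sum.swap[of _ E])

lemma exit_sum_nu_pos:
  assumes \<epsilon>: "0 < \<epsilon>" and g: "\<And>y. y \<in> S - E \<Longrightarrow> 0 \<le> g y"
    and z: "z \<in> E" "y \<in> S - E" "0 < p \<epsilon> z y" "0 < g y"
  shows "0 < exit_sum \<epsilon> \<nu> g"
proof -
  have "0 < \<nu> z * p \<epsilon> z y * g y" using z nu_pos by simp
  also have "\<dots> \<le> (\<Sum>z\<in>E. \<nu> z * p \<epsilon> z y) * g y"
    using z finite_E nu_pos p_nonneg[of \<epsilon>] \<epsilon> E_props(1)
    by (intro mult_right_mono member_le_sum[of z E "\<lambda>z. \<nu> z * p \<epsilon> z y"] mult_nonneg_nonneg)
      (auto simp: less_imp_le)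
  also have "\<dots> \<le> exit_sum \<epsilon> \<nu> g"
    unfolding exit_sum_def
    using z finite_S nu_pos p_nonneg[of \<epsilon>] \<epsilon> g E_props(1)
    by (intro member_le_sum[of y "S - E" "\<lambda>y. (\<Sum>z\<in>E. \<nu> z * p \<epsilon> z y) * g y"] mult_nonneg_nonneg sum_nonneg)
      (auto simp: less_imp_le)
  finally show ?thesis .
qed

text \<open>For positive \<epsilon> the proper nonempty set \<open>E\<close> is not closed, and one
  edge leaving it suffices because \<open>\<nu>\<close> is positive throughout
  \<open>E\<close>.\<close>

lemma lift_Z_pos:
  assumes "0 < \<epsilon>"
  shows "0 < lift_Z S p E \<epsilon>"
proof -
  have "\<not> closed_set S (p \<epsilon>) E"
    using irreducible_p[OF assms] irreducible_iff_closed_set[OF finite_S stochastic_p, of \<epsilon>]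
      assms not_all E_props(2) by auto
  then obtain z y where "z \<in> E" "y \<in> S - E" "0 < p \<epsilon> z y"
    using E_props(1) by (auto simp: closed_set_def)
  then show ?thesis
    unfolding lift_Z_eq by (intro exit_sum_nu_pos[OF assms]) auto
qed

section \<open>The lifted chain at positive parameters\<close>

lemma sum_S':
  "(\<Sum>u\<in>S'. f u) = (\<Sum>y\<in>S - E. f (Inl y)) + f (Inr E)" for f :: "'s + 's set \<Rightarrow> real"
  unfolding lifted_space_def using finite_S by (subst sum.Plus) auto

lemma finite_S': "finite S'"
  using finite_S by (simp add: lifted_space_def)

lemma in_S': "Inl x \<in> S' \<longleftrightarrow> x \<in> S - E" "Inr C \<in> S' \<longleftrightarrow> C = E"
  by (auto simp: lifted_space_def)

lemma S'_cases:
  assumes "u \<in> S'"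
  obtains x where "u = Inl x" "x \<in> S - E" | "u = Inr E"
  using assms by (auto simp: lifted_space_def)

lemma p'_pos: "0 < \<epsilon> \<Longrightarrow> p' \<epsilon> = lifted_matrix S p E \<epsilon>"
  by (simp add: lifted_chain_def)

lemma stochastic_p':
  assumes "0 < \<epsilon>"
  shows "stochastic S' (p' \<epsilon>)"
  unfolding stochastic_def p'_pos[OF assms]
proof (intro ballI conjI)
  fix u v assume u: "u \<in> S'" and v: "v \<in> S'"
  show "0 \<le> lifted_matrix S p E \<epsilon> u v"
    using u v assms lift_Z_pos[OF assms] p_nonneg[of \<epsilon>] E_props(1) nu_pos
    by (elim S'_cases)
      (auto intro!: sum_nonneg mult_nonneg_nonneg divide_nonneg_nonneg simp: less_imp_le subset_iff)
next
  fix u assume u: "u \<in> S'"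
  then show "(\<Sum>v\<in>S'. lifted_matrix S p E \<epsilon> u v) = 1"
  proof (cases rule: S'_cases)
    case (1 x)
    then show ?thesis
      using stochastic_sum[OF stochastic_p, of \<epsilon> x] assms sum_split_E[of "p \<epsilon> x"] by (simp add: sum_S')
  next
    case 2
    then show ?thesis
      using lift_Z_pos[OF assms]
      by (simp add: sum_S' sum_divide_distrib[symmetric] lift_Z_eq exit_sum_def)
  qed
qed

text \<open>A closed set of the lifted chain pulls back to a closed set of the original one, with
  the state \<open>Inr E\<close> expanded to the whole of \<open>E\<close>. Positivity of
  \<open>\<nu>\<close> ensures that every edge out of \<open>E\<close> survives as an edge out of
  \<open>Inr E\<close>.\<close>

lemma irreducible_p':
  assumes \<epsilon>: "0 < \<epsilon>"
  shows "irreducible_chain S' (p' \<epsilon>)"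
  unfolding irreducible_iff_closed_set[OF finite_S' stochastic_p'[OF \<epsilon>]]
proof (intro allI impI)
  fix C' assume C': "closed_set S' (p' \<epsilon>) C'" "C' \<noteq> {}"
  define C where "C = {x \<in> S - E. Inl x \<in> C'} \<union> (if Inr E \<in> C' then E else {})"
  have p0: "0 \<le> \<epsilon>" using \<epsilon> by simp
  have step: "v \<in> C'" if "u \<in> C'" "v \<in> S'" "0 < lifted_matrix S p E \<epsilon> u v" for u v
    using C'(1) that by (auto simp: closed_set_def p'_pos[OF \<epsilon>])
  have "closed_set S (p \<epsilon>) C"
    unfolding closed_set_def
  proof (intro conjI ballI impI)
    show "C \<subseteq> S" using E_props(1) by (auto simp: C_def)
  next
    fix x y assume x: "x \<in> C" and y: "y \<in> S" "0 < p \<epsilon> x y"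
    show "y \<in> C"
    proof (cases "x \<in> E")
      case True
      then have E: "Inr E \<in> C'" using x by (auto simp: C_def split: if_splits)
      show ?thesis
      proof (cases "y \<in> E")
        case False
        have "0 < \<nu> x * p \<epsilon> x y" using y nu_pos[OF True] by simp
        also have "\<dots> \<le> (\<Sum>z\<in>E. \<nu> z * p \<epsilon> z y)"
          using True finite_E nu_pos p_nonneg[OF p0] y(1) E_props(1)
          by (intro member_le_sum[of x E "\<lambda>z. \<nu> z * p \<epsilon> z y"] mult_nonneg_nonneg) (auto simp: less_imp_le)
        finally have "0 < lifted_matrix S p E \<epsilon> (Inr E) (Inl y)"
          using lift_Z_pos[OF \<epsilon>] by simp
        then show ?thesis using step[OF E] y False by (auto simp: C_def in_S')
      qed (use E in \<open>simp add: C_def\<close>)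
    next
      case False
      then have xC: "x \<in> S" "Inl x \<in> C'" using x by (auto simp: C_def split: if_splits)
      show ?thesis
      proof (cases "y \<in> E")
        case True
        have "p \<epsilon> x y \<le> (\<Sum>z\<in>E. p \<epsilon> x z)"
          using True finite_E p_nonneg[OF p0] xC E_props(1) by (intro member_le_sum) auto
        then have "0 < lifted_matrix S p E \<epsilon> (Inl x) (Inr E)" using y by simp
        then show ?thesis using step[OF xC(2)] True by (auto simp: C_def in_S')
      next
        case False
        then show ?thesis using step[OF xC(2), of "Inl y"] y by (auto simp: C_def in_S')
      qed
    qed
  qed
  moreover have "C \<noteq> {}"
  proof -
    obtain u where "u \<in> C'" "u \<in> S'" using C' by (auto simp: closed_set_def)
    then show ?thesis using E_props(2) by (elim S'_cases) (auto simp: C_def)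
  qed
  ultimately have "C = S"
    using irreducible_p[OF \<epsilon>] irreducible_iff_closed_set[OF finite_S stochastic_p[OF p0]] by blast
  then have *: "x \<in> C" if "x \<in> S" for x using that by simp
  have "S' \<subseteq> C'"
  proof
    fix u assume "u \<in> S'"
    then show "u \<in> C'"
    proof (cases rule: S'_cases)
      case (1 x)
      then show ?thesis using *[of x] by (auto simp: C_def split: if_splits)
    next
      case 2
      obtain z where "z \<in> E" using E_props(2) by auto
      then show ?thesis using *[of z] E_props(1) 2 by (auto simp: C_def split: if_splits)
    qed
  qed
  then show "C' = S'" using C'(1) by (auto simp: closed_set_def)
qed

text \<open>
  Redirecting every exit from \<open>E\<close> to a fixed state \<open>z\<^sub>0\<close> gives a chain on \<open>E\<close> that converges to
  the restriction of \<open>p 0\<close>. Weighted by its stationary distribution, the harmonicity equations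
  on \<open>E\<close> telescope to the exit distribution of the chain started in \<open>z\<^sub>0\<close>.
\<close>

definition redirected :: "'s \<Rightarrow> real \<Rightarrow> 's \<Rightarrow> 's \<Rightarrow> real" where
  "redirected z\<^sub>0 \<epsilon> z w = p \<epsilon> z w + (if w = z\<^sub>0 then \<Sum>y\<in>S - E. p \<epsilon> z y else 0)"

lemma stochastic_redirected:
  assumes "0 < \<epsilon>" "z\<^sub>0 \<in> E"
  shows "stochastic E (redirected z\<^sub>0 \<epsilon>)"
  unfolding stochastic_def redirected_def
proof (intro ballI conjI)
  fix z w assume "z \<in> E" "w \<in> E"
  then show "0 \<le> p \<epsilon> z w + (if w = z\<^sub>0 then \<Sum>y\<in>S - E. p \<epsilon> z y else 0)"
    using p_nonneg[of \<epsilon>] assms E_props(1) by (auto intro!: add_nonneg_nonneg sum_nonneg)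
next
  fix z assume z: "z \<in> E"
  then have "(\<Sum>w\<in>E. p \<epsilon> z w) + (\<Sum>y\<in>S - E. p \<epsilon> z y) = 1"
    using stochastic_sum[OF stochastic_p, of \<epsilon> z] assms E_props(1) sum_split_E[of "p \<epsilon> z"] by auto
  then show "(\<Sum>w\<in>E. p \<epsilon> z w + (if w = z\<^sub>0 then \<Sum>y\<in>S - E. p \<epsilon> z y else 0)) = 1"
    using assms(2) finite_E by (simp add: sum.distrib)
qed

lemma tendsto_redirected:
  assumes "z \<in> E" "w \<in> E"
  shows "((\<lambda>\<epsilon>. redirected z\<^sub>0 \<epsilon> z w) \<longlongrightarrow> p 0 z w) (at_right 0)"
proof -
  have S: "z \<in> S" "w \<in> S" using assms E_props(1) by auto
  have "((\<lambda>\<epsilon>. \<Sum>y\<in>S - E. p \<epsilon> z y) \<longlongrightarrow> (\<Sum>y\<in>S - E. p 0 z y)) (at_right 0)"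
    using S by (intro tendsto_sum tendsto_p) auto
  also have "(\<Sum>y\<in>S - E. p 0 z y) = 0" using E_props(6) assms by simp
  finally have "((\<lambda>\<epsilon>. if w = z\<^sub>0 then \<Sum>y\<in>S - E. p \<epsilon> z y else 0) \<longlongrightarrow> 0) (at_right 0)"
    by (cases "w = z\<^sub>0") auto
  from tendsto_add[OF tendsto_p[OF S] this] show ?thesis by (simp add: redirected_def)
qed

text \<open>The sum of \<open>\<mu> w * h w\<close> over \<open>E\<close> is expanded twice, through
  stationarity of \<open>\<mu>\<close> and through harmonicity of \<open>h\<close>. The flow inside
  \<open>E\<close> appears in both expansions and cancels; what remains is the mass returned to
  \<open>z\<^sub>0\<close> and the flow out of \<open>E\<close>.\<close>

lemma exit_sum_harmonic:
  assumes \<mu>: "is_stationary E (redirected z\<^sub>0 \<epsilon>) \<mu>" and z0: "z\<^sub>0 \<in> E"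
    and h: "harmonic_off S (p \<epsilon>) (S - E) h"
  shows "exit_sum \<epsilon> \<mu> (\<lambda>_. 1) * h z\<^sub>0 = exit_sum \<epsilon> \<mu> h"
proof -
  let ?e = "exit_sum \<epsilon> \<mu> (\<lambda>_. 1)"
  have e: "(\<Sum>z\<in>E. \<mu> z * (\<Sum>y\<in>S - E. p \<epsilon> z y)) = ?e"
    unfolding exit_sum_def by (simp add: sum_distrib_left sum.swap[of _ E])
  have mu: "\<mu> w = (\<Sum>z\<in>E. \<mu> z * p \<epsilon> z w) + (if w = z\<^sub>0 then ?e else 0)" if "w \<in> E" for w
  proof -
    have "\<mu> w = (\<Sum>z\<in>E. \<mu> z * redirected z\<^sub>0 \<epsilon> z w)"
      using \<mu> that by (simp add: is_stationary_def)
    then show ?thesis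
      by (cases "w = z\<^sub>0") (simp_all add: redirected_def distrib_left sum.distrib e)
  qed
  have "(\<Sum>w\<in>E. \<mu> w * h w) = (\<Sum>w\<in>E. (\<Sum>z\<in>E. \<mu> z * p \<epsilon> z w) * h w + (if w = z\<^sub>0 then ?e * h w else 0))"
    by (intro sum.cong refl, subst mu) (auto simp: distrib_right)
  also have "\<dots> = (\<Sum>w\<in>E. (\<Sum>z\<in>E. \<mu> z * p \<epsilon> z w) * h w) + ?e * h z\<^sub>0"
    using finite_E z0 by (simp add: sum.distrib)
  finally have 1: "(\<Sum>w\<in>E. \<mu> w * h w) = (\<Sum>w\<in>E. (\<Sum>z\<in>E. \<mu> z * p \<epsilon> z w) * h w) + ?e * h z\<^sub>0" .
  have "(\<Sum>w\<in>E. \<mu> w * h w) = (\<Sum>z\<in>E. \<mu> z * ((\<Sum>y\<in>S - E. p \<epsilon> z y * h y) + (\<Sum>w\<in>E. p \<epsilon> z w * h w)))"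
  proof (intro sum.cong refl)
    fix z assume "z \<in> E"
    then have "h z = (\<Sum>y\<in>S. p \<epsilon> z y * h y)"
      using harmonic_offD[OF h, of z] E_props(1) by auto
    then show "\<mu> z * h z = \<mu> z * ((\<Sum>y\<in>S - E. p \<epsilon> z y * h y) + (\<Sum>w\<in>E. p \<epsilon> z w * h w))"
      by (simp add: sum_split_E)
  qed
  also have "\<dots> = exit_sum \<epsilon> \<mu> h + (\<Sum>w\<in>E. (\<Sum>z\<in>E. \<mu> z * p \<epsilon> z w) * h w)"
  proof -
    have "(\<Sum>z\<in>E. \<mu> z * (\<Sum>y\<in>X. p \<epsilon> z y * h y)) = (\<Sum>y\<in>X. (\<Sum>z\<in>E. \<mu> z * p \<epsilon> z y) * h y)" for X
      by (simp add: sum_distrib_left sum_distrib_right mult.assoc sum.swap[of _ E])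
    then show ?thesis by (simp add: distrib_left sum.distrib exit_sum_def)
  qed
  finally show ?thesis using 1 by simp
qed

text \<open>With \<open>m\<close> the positive minimum of \<open>\<nu>\<close> on \<open>E\<close>,
  an absolute error below \<open>\<delta> * m\<close> is a relative error of at most
  \<open>\<delta>\<close>, uniformly in the finitely many choices of
  \<open>z\<^sub>0\<close>.\<close>

lemma eventually_redirected_close:
  assumes "0 < \<delta>"
  shows "\<forall>\<^sub>F \<epsilon> in at_right 0. \<forall>z\<^sub>0\<in>E. \<exists>\<mu>. is_stationary E (redirected z\<^sub>0 \<epsilon>) \<mu> \<and>
    (\<forall>z\<in>E. (1 - \<delta>) * \<nu> z \<le> \<mu> z \<and> \<mu> z \<le> (1 + \<delta>) * \<nu> z)"
proof (intro eventually_ball_finite finite_E ballI)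
  fix z\<^sub>0 assume z0: "z\<^sub>0 \<in> E"
  define m where "m = Min (\<nu> ` E)"
  have "0 < m" unfolding m_def using finite_E E_props(2) nu_pos by simp
  have m: "m \<le> \<nu> z" if "z \<in> E" for z unfolding m_def using that finite_E by simp
  have "\<forall>\<^sub>F \<epsilon> in at_right 0. \<forall>\<mu>. is_stationary E (redirected z\<^sub>0 \<epsilon>) \<mu> \<longrightarrow>
      (\<forall>z\<in>E. \<bar>\<mu> z - \<nu> z\<bar> < \<delta> * m)"
    using assms \<open>0 < m\<close>
    by (intro eventually_stationary_close[OF finite_E E_props(4,5) stationary_nu] tendsto_redirected) auto
  then show "\<forall>\<^sub>F \<epsilon> in at_right 0. \<exists>\<mu>. is_stationary E (redirected z\<^sub>0 \<epsilon>) \<mu> \<and>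
    (\<forall>z\<in>E. (1 - \<delta>) * \<nu> z \<le> \<mu> z \<and> \<mu> z \<le> (1 + \<delta>) * \<nu> z)"
    using eventually_at_right_less[of 0]
  proof eventually_elim
    case (elim \<epsilon>)
    obtain \<mu> where \<mu>: "is_stationary E (redirected z\<^sub>0 \<epsilon>) \<mu>"
      using exists_stationary[OF finite_E E_props(2) stochastic_redirected] elim z0 by blast
    have "(1 - \<delta>) * \<nu> z \<le> \<mu> z \<and> \<mu> z \<le> (1 + \<delta>) * \<nu> z" if z: "z \<in> E" for z
    proof -
      have "\<bar>\<mu> z - \<nu> z\<bar> < \<delta> * m" using elim \<mu> z by blast
      moreover have "\<delta> * m \<le> \<delta> * \<nu> z" using m[OF z] assms by (intro mult_left_mono) auto
      ultimately show ?thesis unfolding left_diff_distrib distrib_right abs_less_iff by linarith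
    qed
    with \<mu> show ?case by blast
  qed
qed

lemma hits_before_compare:
  assumes AB: "A \<subseteq> S - E" "B \<subseteq> S - E" "A \<union> B \<noteq> {}" and \<epsilon>: "0 < \<epsilon>" and \<delta>: "0 < \<delta>" "\<delta> < 1"
    and close: "\<forall>z\<^sub>0\<in>E. \<exists>\<mu>. is_stationary E (redirected z\<^sub>0 \<epsilon>) \<mu> \<and>
      (\<forall>z\<in>E. (1 - \<delta>) * \<nu> z \<le> \<mu> z \<and> \<mu> z \<le> (1 + \<delta>) * \<nu> z)"
    and x: "x \<in> S"
  defines "v \<equiv> if x \<in> E then Inr E else Inl x"
  shows "(1 - \<delta>) * prob_hits_before S' (p' \<epsilon>) v (Inl ` B) (Inl ` A) \<le> (1 + \<delta>) * prob_hits_before S (p \<epsilon>) x B A"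
    and "(1 - \<delta>) * prob_hits_before S (p \<epsilon>) x B A \<le> (1 + \<delta>) * prob_hits_before S' (p' \<epsilon>) v (Inl ` B) (Inl ` A)"
proof -
  note st = stochastic_p[OF less_imp_le[OF \<epsilon>]] and irr = irreducible_p[OF \<epsilon>]
  note dir = prob_hits_before_dirichlet[OF finite_S st]
  note dir' = prob_hits_before_dirichlet[OF finite_S' stochastic_p'[OF \<epsilon>]]
  note harm = harmonic_off_prob_hits_before[OF finite_S st]
  let ?D = "A \<union> B \<union> E"
  define h where "h x = prob_hits_before S (p \<epsilon>) x B A" for x
  define r where "r x = prob_hits_before S (p \<epsilon>) x B (A \<union> E)" for x
  define t where "t x = prob_hits_before S (p \<epsilon>) x E (A \<union> B)" for x
  define h' where "h' u = prob_hits_before S' (p' \<epsilon>) u (Inl ` B) (Inl ` A)" for u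
  define k where "k = h' (Inr E)"
  define H where "H x = (if x \<in> E then k else h' (Inl x))" for x
  have nn: "0 \<le> h x" "0 \<le> r x" "0 \<le> t x" "0 \<le> h' u" "0 \<le> k" for x u
    by (simp_all add: h_def r_def t_def h'_def k_def prob_hits_before_nonneg)
  have t1: "t x \<le> 1" if "x \<in> S" for x
    unfolding t_def by (rule path_measure_hits_before(2)[OF finite_S st that])
  have hh: "harmonic_off S (p \<epsilon>) (A \<union> B) h" unfolding h_def[abs_def] by (rule harm)
  have "harmonic_off S (p \<epsilon>) ?D r" "harmonic_off S (p \<epsilon>) ?D t"
    unfolding r_def[abs_def] t_def[abs_def]
    by (rule harmonic_off_mono[OF harm]; auto)+
  then have rt: "harmonic_off S (p \<epsilon>) ?D (\<lambda>x. r x + c * t x)" for c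
    by (rule harmonic_off_add_cmult)
  have hD: "harmonic_off S (p \<epsilon>) ?D h" using hh by (rule harmonic_off_mono) auto
  have DS: "?D \<inter> S \<noteq> {}" using E_props(1,2) by auto
  have bd_r: "r x = (if x \<in> B - A then 1 else 0)" if "x \<in> S" "x \<in> ?D" for x
    using dir(1,2)[OF that(1), of "A \<union> E" B] dir(2)[OF that(1), of B "A \<union> E"] that(2) AB
    by (auto simp: r_def)
  have bd_t: "t x = (if x \<in> E then 1 else 0)" if "x \<in> S" "x \<in> ?D" for x
    using dir(1)[OF that(1), of "A \<union> B" E] dir(2)[OF that(1), of E "A \<union> B"] that(2) AB
    by (auto simp: t_def)
  have bd_h: "h x = (if x \<in> B - A then 1 else 0)" if "x \<in> S" "x \<in> A \<union> B" for x
    using dir(1)[OF that(1), of A B] dir(2)[OF that(1), of B A] that(2)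
    by (auto simp: h_def)
  \<comment> \<open>\<open>r + m * t\<close> solves the Dirichlet problem off
    \<open>A \<union> B \<union> E\<close> with the boundary values of \<open>h\<close> on
    \<open>A \<union> B\<close> and the constant \<open>m\<close> on \<open>E\<close>, so the
    comparison principle applies.\<close>
  have low: "r x + m * t x \<le> h x" if "\<And>z. z \<in> E \<Longrightarrow> m \<le> h z" "x \<in> S" for x m
    by (rule harmonic_off_le[OF finite_S st irr DS rt hD _ that(2)])
      (use that(1) bd_r bd_t bd_h AB in auto)
  have upp: "h x \<le> r x + m * t x" if "\<And>z. z \<in> E \<Longrightarrow> h z \<le> m" "x \<in> S" for x m
    by (rule harmonic_off_le[OF finite_S st irr DS hD rt _ that(2)])
      (use that(1) bd_r bd_t bd_h AB in auto)
  \<comment> \<open>\<open>H\<close> is the lifted solution pulled back to \<open>S\<close>,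
    constant on \<open>E\<close>. A row of the lifted matrix outside \<open>E\<close> merely adds up
    the entries into \<open>E\<close>, so harmonicity there is unchanged.\<close>
  have HD: "harmonic_off S (p \<epsilon>) ?D H"
    unfolding harmonic_off_def
  proof
    fix x assume x: "x \<in> S - ?D"
    then have "h' (Inl x) = (\<Sum>u\<in>S'. p' \<epsilon> (Inl x) u * h' u)"
      unfolding h'_def by (intro dir'(3)) (auto simp: in_S')
    also have "\<dots> = (\<Sum>y\<in>S - E. p \<epsilon> x y * H y) + (\<Sum>z\<in>E. p \<epsilon> x z * H z)"
      by (simp add: sum_S' p'_pos[OF \<epsilon>] H_def k_def sum_distrib_right)
    finally show "H x = (\<Sum>y\<in>S. p \<epsilon> x y * H y)" using x by (simp add: sum_split_E H_def)
  qed
  have bd_H: "H x = r x + k * t x" if "x \<in> S" "x \<in> ?D" for x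
  proof (cases "x \<in> E")
    case True
    then show ?thesis using bd_r[OF that] bd_t[OF that] AB by (auto simp: H_def)
  next
    case False
    then have "Inl x \<in> S'" using that by (simp add: in_S')
    from dir'(1)[OF this, of "Inl ` A" "Inl ` B"] dir'(2)[OF this, of "Inl ` B" "Inl ` A"]
    show ?thesis using False bd_r[OF that] bd_t[OF that] that by (auto simp: H_def h'_def)
  qed
  have H: "H x = r x + k * t x" if "x \<in> S" for x
    by (intro antisym harmonic_off_le[OF finite_S st irr DS HD rt _ that]
        harmonic_off_le[OF finite_S st irr DS rt HD _ that]) (auto simp: bd_H)
  \<comment> \<open>The lifted equation at \<open>Inr E\<close> contains \<open>k\<close> on both
    sides, as the chain may return to \<open>E\<close>; collecting these terms produces the weight
    \<open>1 - t\<close>.\<close>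
  have k_eq: "k * exit_sum \<epsilon> \<nu> (\<lambda>y. 1 + (- 1) * t y) = exit_sum \<epsilon> \<nu> r"
  proof -
    have "k = (\<Sum>u\<in>S'. p' \<epsilon> (Inr E) u * h' u)"
      unfolding k_def h'_def by (intro dir'(3)) (auto simp: in_S')
    also have "\<dots> = exit_sum \<epsilon> \<nu> H / lift_Z S p E \<epsilon>"
      by (simp add: sum_S' p'_pos[OF \<epsilon>] H_def exit_sum_def sum_divide_distrib[symmetric])
    finally have "k * exit_sum \<epsilon> \<nu> (\<lambda>_. 1) = exit_sum \<epsilon> \<nu> H"
      using lift_Z_pos[OF \<epsilon>] by (simp add: lift_Z_eq field_simps)
    also have "\<dots> = exit_sum \<epsilon> \<nu> (\<lambda>y. r y + k * t y)"
      unfolding exit_sum_def using H by simp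
    finally show ?thesis unfolding exit_sum_linear by (simp add: algebra_simps)
  qed
  define K where "K = exit_sum \<epsilon> \<nu> (\<lambda>y. 1 + (- 1) * t y)"
  \<comment> \<open>If \<open>K\<close> were not positive, every exit from \<open>E\<close> would
    return with certainty. Then \<open>t = 1\<close> would propagate along edges: trivially into
    \<open>E\<close>, by assumption out of \<open>E\<close>, and elsewhere because an average of
    values at most 1 equals 1. By irreducibility it would hold on \<open>A \<union> B\<close>, where
    \<open>t = 0\<close>.\<close>
  have K: "0 < K"
  proof (rule ccontr)
    assume "\<not> 0 < K"
    then have *: "t y = 1" if "z \<in> E" "y \<in> S - E" "0 < p \<epsilon> z y" for z y
      using exit_sum_nu_pos[OF \<epsilon> _ that, of "\<lambda>y. 1 + (- 1) * t y"] t1 that by (force simp: K_def)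
    define C where "C = {y \<in> S. t y = 1}"
    have "closed_set S (p \<epsilon>) C"
      unfolding closed_set_def
    proof (intro conjI ballI impI)
      fix y z assume y: "y \<in> C" and z: "z \<in> S" "0 < p \<epsilon> y z"
      show "z \<in> C"
      proof (cases "z \<in> E \<or> y \<in> E")
        case True
        then show ?thesis using *[of y z] z y bd_t[of z] by (cases "z \<in> E") (auto simp: C_def)
      next
        case False
        have yS: "y \<in> S" "t y = 1" using y by (auto simp: C_def)
        then have "y \<notin> A \<union> B" using bd_t[of y] False by auto
        then have "1 = (\<Sum>w\<in>S. p \<epsilon> y w * t w)"
          using yS False dir(3)[OF yS(1), of "A \<union> B" E] by (simp add: t_def)
        then have "(\<Sum>w\<in>S. p \<epsilon> y w * (1 - t w)) = 0"
          using stochastic_sum[OF st yS(1)] by (simp add: right_diff_distrib sum_subtractf)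
        moreover have "0 \<le> p \<epsilon> y w * (1 - t w)" if "w \<in> S" for w
          using stochastic_nonneg[OF st yS(1) that] t1[OF that] by simp
        ultimately have "p \<epsilon> y z * (1 - t z) = 0"
          using sum_nonneg_eq_0_iff[OF finite_S, of "\<lambda>w. p \<epsilon> y w * (1 - t w)"] z by blast
        then show ?thesis using z by (simp add: C_def)
      qed
    qed (auto simp: C_def)
    moreover have "C \<noteq> {}"
    proof -
      obtain z where "z \<in> E" using E_props(2) by blast
      then have "z \<in> C" using bd_t[of z] E_props(1) by (auto simp: C_def)
      then show ?thesis by blast
    qed
    ultimately have "C = S" using irr irreducible_iff_closed_set[OF finite_S st] by blast
    obtain d where d: "d \<in> A \<union> B" using AB(3) by blast
    then have dS: "d \<in> S" "d \<notin> E" using AB(1,2) by auto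
    then have "d \<in> C" using \<open>C = S\<close> by simp
    then have "t d = 1" "t d = 0" using bd_t[of d] d dS by (auto simp: C_def)
    then show False by simp
  qed
  have hE: "harmonic_off S (p \<epsilon>) (S - E) h" using hh AB by (intro harmonic_off_mono[OF hh]) auto
  \<comment> \<open>At a minimiser, \<open>low\<close> holds with \<open>m = h z\<^sub>0\<close>,
    and the exit identity started there turns it into an inequality for \<open>h z\<^sub>0\<close>
    alone. It is compared with \<open>k_eq\<close> after changing weights once on \<open>r\<close>
    and once on \<open>1 - t\<close>.\<close>
  have lowE: "(1 - \<delta>) * k \<le> (1 + \<delta>) * h z\<^sub>0" if z0: "z\<^sub>0 \<in> E" "\<And>z. z \<in> E \<Longrightarrow> h z\<^sub>0 \<le> h z" for z\<^sub>0
  proof -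
    obtain \<mu> where \<mu>: "is_stationary E (redirected z\<^sub>0 \<epsilon>) \<mu>"
      "\<And>z. z \<in> E \<Longrightarrow> (1 - \<delta>) * \<nu> z \<le> \<mu> z" "\<And>z. z \<in> E \<Longrightarrow> \<mu> z \<le> (1 + \<delta>) * \<nu> z"
      using close z0(1) by blast
    have \<mu>0: "0 \<le> \<mu> z" for z using is_stationary_le_1[OF finite_E \<mu>(1)] by simp
    have "exit_sum \<epsilon> \<mu> (\<lambda>y. r y + h z\<^sub>0 * t y) \<le> exit_sum \<epsilon> \<mu> h"
      using \<mu>0 low[OF z0(2)] by (intro exit_sum_mono \<epsilon>) auto
    also have "\<dots> = exit_sum \<epsilon> \<mu> (\<lambda>_. 1) * h z\<^sub>0"
      by (rule exit_sum_harmonic[OF \<mu>(1) z0(1) hE, symmetric])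
    finally have 1: "exit_sum \<epsilon> \<mu> r \<le> h z\<^sub>0 * exit_sum \<epsilon> \<mu> (\<lambda>y. 1 + (- 1) * t y)"
      unfolding exit_sum_linear by (simp add: algebra_simps)
    have "((1 - \<delta>) * k) * K = (1 - \<delta>) * exit_sum \<epsilon> \<nu> r"
      using k_eq by (simp add: K_def)
    also have "\<dots> \<le> 1 * exit_sum \<epsilon> \<mu> r"
      using \<mu>(2) nn by (intro exit_sum_cmult_mono[OF \<epsilon>]) auto
    also have "\<dots> \<le> h z\<^sub>0 * (1 * exit_sum \<epsilon> \<mu> (\<lambda>y. 1 + (- 1) * t y))" using 1 by simp
    also have "\<dots> \<le> h z\<^sub>0 * ((1 + \<delta>) * K)"
      unfolding K_def using \<mu>(3) t1 nn by (intro mult_left_mono exit_sum_cmult_mono[OF \<epsilon>]) auto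
    finally have "((1 - \<delta>) * k) * K \<le> ((1 + \<delta>) * h z\<^sub>0) * K" by (simp add: mult_ac)
    then show ?thesis using K by simp
  qed
  have uppE: "(1 - \<delta>) * h z\<^sub>0 \<le> (1 + \<delta>) * k" if z0: "z\<^sub>0 \<in> E" "\<And>z. z \<in> E \<Longrightarrow> h z \<le> h z\<^sub>0" for z\<^sub>0
  proof -
    obtain \<mu> where \<mu>: "is_stationary E (redirected z\<^sub>0 \<epsilon>) \<mu>"
      "\<And>z. z \<in> E \<Longrightarrow> (1 - \<delta>) * \<nu> z \<le> \<mu> z" "\<And>z. z \<in> E \<Longrightarrow> \<mu> z \<le> (1 + \<delta>) * \<nu> z"
      using close z0(1) by blast
    have \<mu>0: "0 \<le> \<mu> z" for z using is_stationary_le_1[OF finite_E \<mu>(1)] by simp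
    have "exit_sum \<epsilon> \<mu> (\<lambda>_. 1) * h z\<^sub>0 = exit_sum \<epsilon> \<mu> h"
      by (rule exit_sum_harmonic[OF \<mu>(1) z0(1) hE])
    also have "\<dots> \<le> exit_sum \<epsilon> \<mu> (\<lambda>y. r y + h z\<^sub>0 * t y)"
      using \<mu>0 upp[OF z0(2)] by (intro exit_sum_mono \<epsilon>) auto
    finally have 1: "h z\<^sub>0 * exit_sum \<epsilon> \<mu> (\<lambda>y. 1 + (- 1) * t y) \<le> exit_sum \<epsilon> \<mu> r"
      unfolding exit_sum_linear by (simp add: algebra_simps)
    have "((1 - \<delta>) * h z\<^sub>0) * K = h z\<^sub>0 * ((1 - \<delta>) * K)" by simp
    also have "\<dots> \<le> h z\<^sub>0 * (1 * exit_sum \<epsilon> \<mu> (\<lambda>y. 1 + (- 1) * t y))"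
      unfolding K_def using \<mu>(2) t1 nn by (intro mult_left_mono exit_sum_cmult_mono[OF \<epsilon>]) auto
    also have "\<dots> \<le> 1 * exit_sum \<epsilon> \<mu> r" using 1 by simp
    also have "\<dots> \<le> (1 + \<delta>) * exit_sum \<epsilon> \<nu> r"
      using \<mu>(3) nn by (intro exit_sum_cmult_mono[OF \<epsilon>]) auto
    also have "\<dots> = ((1 + \<delta>) * k) * K"
      using k_eq by (simp add: K_def)
    finally show ?thesis using K by simp
  qed
  have "Min (h ` E) \<in> h ` E" "Max (h ` E) \<in> h ` E"
    using finite_E E_props(2) by (auto intro!: Min_in Max_in)
  then obtain z0 z1 where "z0 \<in> E" "h z0 = Min (h ` E)" "z1 \<in> E" "h z1 = Max (h ` E)"
    by (elim imageE) simp
  then have z0: "z0 \<in> E" "\<And>z. z \<in> E \<Longrightarrow> h z0 \<le> h z"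
    and z1: "z1 \<in> E" "\<And>z. z \<in> E \<Longrightarrow> h z \<le> h z1"
    using finite_E by simp_all
  have v: "prob_hits_before S' (p' \<epsilon>) v (Inl ` B) (Inl ` A) = r x + k * t x"
    using H[OF x] x by (simp add: v_def H_def h'_def k_def split: if_splits)
  have r: "(1 - \<delta>) * r x \<le> (1 + \<delta>) * r x" using nn \<delta> by (intro mult_right_mono) auto
  have "(1 - \<delta>) * (r x + k * t x) = (1 - \<delta>) * r x + ((1 - \<delta>) * k) * t x"
    by (simp add: distrib_left)
  also have "\<dots> \<le> (1 + \<delta>) * r x + ((1 + \<delta>) * h z0) * t x"
    by (intro add_mono r mult_right_mono[OF lowE[OF z0]] nn)
  also have "\<dots> = (1 + \<delta>) * (r x + h z0 * t x)" by (simp add: distrib_left)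
  also have "\<dots> \<le> (1 + \<delta>) * h x"
    using low[OF z0(2) x] \<delta> by (intro mult_left_mono) auto
  finally show "(1 - \<delta>) * prob_hits_before S' (p' \<epsilon>) v (Inl ` B) (Inl ` A) \<le> (1 + \<delta>) * prob_hits_before S (p \<epsilon>) x B A"
    by (simp add: v h_def)
  have "(1 - \<delta>) * h x \<le> (1 - \<delta>) * (r x + h z1 * t x)"
    using upp[OF z1(2) x] \<delta> by (intro mult_left_mono) auto
  also have "\<dots> = (1 - \<delta>) * r x + ((1 - \<delta>) * h z1) * t x" by (simp add: distrib_left)
  also have "\<dots> \<le> (1 + \<delta>) * r x + ((1 + \<delta>) * k) * t x"
    by (intro add_mono r mult_right_mono[OF uppE[OF z1]] nn)
  also have "\<dots> = (1 + \<delta>) * (r x + k * t x)" by (simp add: distrib_left)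
  finally show "(1 - \<delta>) * prob_hits_before S (p \<epsilon>) x B A \<le> (1 + \<delta>) * prob_hits_before S' (p' \<epsilon>) v (Inl ` B) (Inl ` A)"
    by (simp add: v h_def)
qed

section \<open>Asymptotics of the hitting probabilities\<close>

lemma hits_before_asymp_equiv:
  assumes AB: "A \<subseteq> S - E" "B \<subseteq> S - E" and x: "x \<in> S"
  defines "v \<equiv> if x \<in> E then Inr E else Inl x"
  shows "(\<lambda>\<epsilon>. prob_hits_before S (p \<epsilon>) x B A) \<sim>[at_right 0]
    (\<lambda>\<epsilon>. prob_hits_before S' (p' \<epsilon>) v (Inl ` B) (Inl ` A))"
proof (rule asymp_equiv_atI_ratio)
  fix \<delta> :: real assume \<delta>: "0 < \<delta>" "\<delta> < 1"
  have "v \<in> S'" using x by (simp add: v_def in_S')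
  show "\<forall>\<^sub>F \<epsilon> in at_right 0.
      (1 - \<delta>) * prob_hits_before S' (p' \<epsilon>) v (Inl ` B) (Inl ` A) \<le> (1 + \<delta>) * prob_hits_before S (p \<epsilon>) x B A \<and>
      (1 - \<delta>) * prob_hits_before S (p \<epsilon>) x B A \<le> (1 + \<delta>) * prob_hits_before S' (p' \<epsilon>) v (Inl ` B) (Inl ` A)"
    using eventually_redirected_close[OF \<delta>(1)] eventually_at_right_less[of 0]
  proof eventually_elim
    case (elim \<epsilon>)
    show ?case
    \<comment> \<open>With no target at all, both probabilities are 0 and the comparison, which
      divides by the escape weight, is bypassed.\<close>
    proof (cases "A \<union> B = {}")
      case True
      then show ?thesis
        using prob_hits_before_no_target[OF finite_S stochastic_p x, of \<epsilon> B A]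
          prob_hits_before_no_target[OF finite_S' stochastic_p' \<open>v \<in> S'\<close>, of \<epsilon> "Inl ` B" "Inl ` A"] elim
        by simp
    next
      case False
      then show ?thesis
        using hits_before_compare[OF AB False elim(2) \<delta> elim(1) x] unfolding v_def by blast
    qed
  qed
qed (simp_all add: prob_hits_before_nonneg)

text \<open>Each entry is, up to the positive normaliser, a sum of nonnegative entries with strictly
  positive weights, so it is identically 0 or bounded below by one eventually positive
  summand.\<close>

lemma zero_or_positive_p':
  assumes zp: "\<forall>x\<in>S. \<forall>y\<in>S. zero_or_positive (\<lambda>\<epsilon>. p \<epsilon> x y)" and u: "u \<in> S'" "v \<in> S'"
  shows "zero_or_positive (\<lambda>\<epsilon>. p' \<epsilon> u v)"
proof -
  have sum: "zero_or_positive (\<lambda>\<epsilon>. \<Sum>i\<in>I. a i * f i \<epsilon>)"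
    if I: "finite I" and a: "\<And>i. i \<in> I \<Longrightarrow> 0 < a i"
      and f: "\<And>i. i \<in> I \<Longrightarrow> zero_or_positive (f i)" "\<And>i \<epsilon>. i \<in> I \<Longrightarrow> 0 < \<epsilon> \<Longrightarrow> 0 \<le> f i \<epsilon>" for I :: "'s set" and a :: "'s \<Rightarrow> real" and f
  proof (cases "\<forall>i\<in>I. \<forall>\<epsilon>>0. f i \<epsilon> = 0")
    case True
    then show ?thesis by (simp add: zero_or_positive_def)
  next
    case False
    then obtain j where j: "j \<in> I" "\<forall>\<^sub>F \<epsilon> in at_right 0. 0 < f j \<epsilon>"
      using f(1) by (auto simp: zero_or_positive_iff_eventually)
    have "\<forall>\<^sub>F \<epsilon> in at_right 0. 0 < (\<Sum>i\<in>I. a i * f i \<epsilon>)"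
      using j(2) eventually_at_right_less[of 0]
    proof eventually_elim
      case (elim \<epsilon>)
      then have "0 < a j * f j \<epsilon>" using a j by simp
      also have "\<dots> \<le> (\<Sum>i\<in>I. a i * f i \<epsilon>)"
        using I f(2) elim j less_imp_le[OF a] by (intro member_le_sum[of j I "\<lambda>i. a i * f i \<epsilon>"] mult_nonneg_nonneg) auto
      finally show ?case .
    qed
    then show ?thesis by (simp add: zero_or_positive_iff_eventually)
  qed
  have cong: "zero_or_positive (\<lambda>\<epsilon>. p' \<epsilon> u v)" if "zero_or_positive f" "\<And>\<epsilon>. 0 < \<epsilon> \<Longrightarrow> 0 < f \<epsilon> \<longleftrightarrow> 0 < p' \<epsilon> u v"
    "\<And>\<epsilon>. 0 < \<epsilon> \<Longrightarrow> f \<epsilon> = 0 \<longleftrightarrow> p' \<epsilon> u v = 0" for f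
    using that by (simp add: zero_or_positive_def)
  have ES: "z \<in> E \<Longrightarrow> z \<in> S" for z using E_props(1) by auto
  from u(1) show ?thesis
  proof (cases rule: S'_cases)
    case (1 x)
    from u(2) show ?thesis
    proof (cases rule: S'_cases)
      case (1 y)
      show ?thesis
        by (rule cong[of "\<lambda>\<epsilon>. p \<epsilon> x y"]) (use 1 \<open>u = Inl x\<close> \<open>x \<in> S - E\<close> zp in \<open>auto simp: p'_pos\<close>)
    next
      case 2
      have "zero_or_positive (\<lambda>\<epsilon>. \<Sum>z\<in>E. 1 * p \<epsilon> x z)"
        using finite_E zp ES \<open>x \<in> S - E\<close> p_nonneg by (intro sum) auto
      then show ?thesis
        by (rule cong) (use 2 \<open>u = Inl x\<close> in \<open>auto simp: p'_pos\<close>)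
    qed
  next
    case 2
    from u(2) show ?thesis
    proof (cases rule: S'_cases)
      case (1 y)
      have "zero_or_positive (\<lambda>\<epsilon>. \<Sum>z\<in>E. \<nu> z * p \<epsilon> z y)"
        using finite_E zp ES \<open>y \<in> S - E\<close> p_nonneg nu_pos by (intro sum) auto
      then show ?thesis
      proof (rule cong)
        fix \<epsilon> :: real assume \<epsilon>: "0 < \<epsilon>"
        show "0 < (\<Sum>z\<in>E. \<nu> z * p \<epsilon> z y) \<longleftrightarrow> 0 < p' \<epsilon> u v"
          "(\<Sum>z\<in>E. \<nu> z * p \<epsilon> z y) = 0 \<longleftrightarrow> p' \<epsilon> u v = 0"
          using lift_Z_pos[OF \<epsilon>] 1 2 \<epsilon> by (simp_all add: p'_pos zero_less_divide_iff)
      qed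
    next
      case 2
      show ?thesis
        by (rule cong[of "\<lambda>_. 0"]) (use 2 \<open>u = Inr E\<close> in \<open>auto simp: p'_pos zero_or_positive_def\<close>)
    qed
  qed
qed

lemma hits_before_asymptotic_to:
  assumes AB: "A \<subseteq> S - E" "B \<subseteq> S - E" and x: "x \<in> S"
    and zp: "\<forall>x\<in>S. \<forall>y\<in>S. zero_or_positive (\<lambda>\<epsilon>. p \<epsilon> x y)"
  defines "v \<equiv> if x \<in> E then Inr E else Inl x"
  shows "asymptotic_to (\<lambda>\<epsilon>. prob_hits_before S (p \<epsilon>) x B A)
    (\<lambda>\<epsilon>. prob_hits_before S' (p' \<epsilon>) v (Inl ` B) (Inl ` A))"
proof (rule asymptotic_toI)
  show "(\<lambda>\<epsilon>. prob_hits_before S (p \<epsilon>) x B A) \<sim>[at_right 0]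
      (\<lambda>\<epsilon>. prob_hits_before S' (p' \<epsilon>) v (Inl ` B) (Inl ` A))"
    unfolding v_def by (rule hits_before_asymp_equiv[OF AB x])
  show "zero_or_positive (\<lambda>\<epsilon>. prob_hits_before S (p \<epsilon>) x B A)"
    using zp x by (intro zero_or_positive_prob_hits_before finite_S stochastic_p irreducible_p) auto
  show "zero_or_positive (\<lambda>\<epsilon>. prob_hits_before S' (p' \<epsilon>) v (Inl ` B) (Inl ` A))"
    using zp x by (intro zero_or_positive_prob_hits_before finite_S' stochastic_p' irreducible_p'
        zero_or_positive_p') (auto simp: v_def in_S')
qed

end

section \<open>Regularity of the lifted chain\<close>

text \<open>
  Comparability passes to sums because limits in \<open>[0, \<infinity>]\<close> add, and it is symmetric because
  inversion is continuous there.
\<close>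

lemma comparable_cong:
  assumes "\<And>\<epsilon>. 0 < \<epsilon> \<Longrightarrow> a \<epsilon> = a' \<epsilon>" "\<And>\<epsilon>. 0 < \<epsilon> \<Longrightarrow> b \<epsilon> = b' \<epsilon>"
  shows "comparable a b \<longleftrightarrow> comparable a' b'"
proof -
  have "((\<lambda>\<epsilon>. ennreal (a \<epsilon> / b \<epsilon>)) \<longlongrightarrow> L) (at_right 0) \<longleftrightarrow>
      ((\<lambda>\<epsilon>. ennreal (a' \<epsilon> / b' \<epsilon>)) \<longlongrightarrow> L) (at_right 0)" for L
    using eventually_at_right_less[of "0::real"]
    by (intro tendsto_cong) (auto elim!: eventually_mono simp: assms)
  then show ?thesis
    unfolding comparable_def by (simp add: assms cong: conj_cong imp_cong)
qed

lemma comparable_cases: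
  assumes "comparable a b"
  obtains "\<And>\<epsilon>. 0 < \<epsilon> \<Longrightarrow> a \<epsilon> = 0" | "\<And>\<epsilon>. 0 < \<epsilon> \<Longrightarrow> b \<epsilon> = 0"
  | L :: ennreal where "\<And>\<epsilon>. 0 < \<epsilon> \<Longrightarrow> 0 < a \<epsilon>" "\<And>\<epsilon>. 0 < \<epsilon> \<Longrightarrow> 0 < b \<epsilon>"
      "((\<lambda>\<epsilon>. ennreal (a \<epsilon> / b \<epsilon>)) \<longlongrightarrow> L) (at_right 0)"
  using assms unfolding comparable_def by blast

lemma comparableI:
  assumes "\<And>\<epsilon>. 0 < \<epsilon> \<Longrightarrow> 0 < a \<epsilon>" "\<And>\<epsilon>. 0 < \<epsilon> \<Longrightarrow> 0 < b \<epsilon>"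
    "((\<lambda>\<epsilon>. ennreal (a \<epsilon> / b \<epsilon>)) \<longlongrightarrow> L) (at_right 0)"
  shows "comparable a b"
  using assms unfolding comparable_def by blast

lemma comparable_zero:
  "(\<And>\<epsilon>. 0 < \<epsilon> \<Longrightarrow> a \<epsilon> = 0) \<Longrightarrow> comparable a b" "(\<And>\<epsilon>. 0 < \<epsilon> \<Longrightarrow> b \<epsilon> = 0) \<Longrightarrow> comparable a b"
  by (auto simp: comparable_def)

lemma comparable_sym:
  assumes "comparable a b"
  shows "comparable b a"
  using assms
proof (cases rule: comparable_cases)
  case (3 L)
  have "((\<lambda>\<epsilon>. inverse (ennreal (a \<epsilon> / b \<epsilon>))) \<longlongrightarrow> inverse L) (at_right 0)"
    using 3(3) by (rule continuous_on_tendsto_compose[OF continuous_on_inverse_ennreal[OF continuous_on_id], where s=UNIV]) auto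
  moreover have "\<forall>\<^sub>F \<epsilon> in at_right 0. inverse (ennreal (a \<epsilon> / b \<epsilon>)) = ennreal (b \<epsilon> / a \<epsilon>)"
    using eventually_at_right_less[of 0]
    by eventually_elim (use 3(1,2) in \<open>simp add: inverse_ennreal\<close>)
  ultimately have "((\<lambda>\<epsilon>. ennreal (b \<epsilon> / a \<epsilon>)) \<longlongrightarrow> inverse L) (at_right 0)"
    by (rule Lim_transform_eventually)
  then show ?thesis by (rule comparableI[rotated 2]) (use 3(1,2) in auto)
qed (auto intro: comparable_zero)

lemma comparable_add:
  assumes "comparable a c" "comparable b c"
  shows "comparable (\<lambda>\<epsilon>. a \<epsilon> + b \<epsilon>) c"
  using assms(1)
proof (cases rule: comparable_cases)
  case 1
  then show ?thesis using assms(2) comparable_cong[of b "\<lambda>\<epsilon>. a \<epsilon> + b \<epsilon>" c c] by simp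
next
  case a: (3 L)
  show ?thesis
    using assms(2)
  proof (cases rule: comparable_cases)
    case 1
    then show ?thesis using assms(1) comparable_cong[of a "\<lambda>\<epsilon>. a \<epsilon> + b \<epsilon>" c c] by simp
  next
    case b: (3 L')
    have "((\<lambda>\<epsilon>. ennreal (a \<epsilon> / c \<epsilon>) + ennreal (b \<epsilon> / c \<epsilon>)) \<longlongrightarrow> L + L') (at_right 0)"
      by (intro tendsto_add a b)
    moreover have "\<forall>\<^sub>F \<epsilon> in at_right 0.
        ennreal (a \<epsilon> / c \<epsilon>) + ennreal (b \<epsilon> / c \<epsilon>) = ennreal ((a \<epsilon> + b \<epsilon>) / c \<epsilon>)"
      using eventually_at_right_less[of 0]
      by eventually_elim
        (use a(1,2) b(1) in \<open>simp add: ennreal_plus[symmetric] add_divide_distrib less_imp_le del: ennreal_plus\<close>)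
    ultimately have "((\<lambda>\<epsilon>. ennreal ((a \<epsilon> + b \<epsilon>) / c \<epsilon>)) \<longlongrightarrow> L + L') (at_right 0)"
      by (rule Lim_transform_eventually)
    then show ?thesis
      by (rule comparableI[rotated 2]) (use a(1,2) b(1) in \<open>auto intro: add_pos_pos\<close>)
  qed (auto intro: comparable_zero)
qed (auto intro: comparable_zero)

lemma comparable_cmult:
  assumes "comparable a b" "0 \<le> c"
  shows "comparable (\<lambda>\<epsilon>. c * a \<epsilon>) b"
proof (cases "c = 0")
  case True
  then show ?thesis by (intro comparable_zero(1)) simp
next
  case False
  with assms(2) have c: "0 < c" by simp
  from assms(1) show ?thesis
  proof (cases rule: comparable_cases)
    case (3 L)
    have "((\<lambda>\<epsilon>. ennreal c * ennreal (a \<epsilon> / b \<epsilon>)) \<longlongrightarrow> ennreal c * L) (at_right 0)"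
      using 3(3) by (intro ennreal_tendsto_cmult) auto
    moreover have "\<forall>\<^sub>F \<epsilon> in at_right 0. ennreal c * ennreal (a \<epsilon> / b \<epsilon>) = ennreal (c * a \<epsilon> / b \<epsilon>)"
      using eventually_at_right_less[of 0]
      by eventually_elim (use 3(1,2) c in \<open>simp add: ennreal_mult[symmetric] less_imp_le\<close>)
    ultimately have "((\<lambda>\<epsilon>. ennreal (c * a \<epsilon> / b \<epsilon>)) \<longlongrightarrow> ennreal c * L) (at_right 0)"
      by (rule Lim_transform_eventually)
    then show ?thesis
      by (rule comparableI[rotated 2]) (use 3(1,2) c in auto)
  qed (auto intro: comparable_zero)
qed

text \<open>Polynomials in the matrix entries with nonnegative coefficients. The sign condition
  excludes cancellation, so comparability of monomials extends to all of them.\<close>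

inductive entry_poly :: "'s set \<Rightarrow> (real \<Rightarrow> 's \<Rightarrow> 's \<Rightarrow> real) \<Rightarrow> (real \<Rightarrow> real) \<Rightarrow> bool" for S p where
  monom: "0 \<le> c \<Longrightarrow> set us \<subseteq> S \<times> S \<Longrightarrow> entry_poly S p (\<lambda>\<epsilon>. c * (\<Prod>(x, y)\<leftarrow>us. p \<epsilon> x y))"
| add: "entry_poly S p a \<Longrightarrow> entry_poly S p b \<Longrightarrow> entry_poly S p (\<lambda>\<epsilon>. a \<epsilon> + b \<epsilon>)"

text \<open>Sums and multiples are handled only in the first argument of \<open>comparable\<close>.
  The inner induction therefore treats \<open>b\<close> against a fixed monomial, symmetry exchanges
  the sides, and the outer induction treats \<open>a\<close>.\<close>

lemma entry_poly_comparable: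
  assumes reg: "regular_chain S p" and "entry_poly S p a" "entry_poly S p b"
  shows "comparable a b"
  using assms(2)
proof induction
  case (monom c us)
  have "comparable b (\<lambda>\<epsilon>. \<Prod>(x, y)\<leftarrow>us. p \<epsilon> x y)"
    using assms(3)
  proof induction
    case (monom d vs)
    then have "comparable (\<lambda>\<epsilon>. \<Prod>(x, y)\<leftarrow>vs. p \<epsilon> x y) (\<lambda>\<epsilon>. \<Prod>(x, y)\<leftarrow>us. p \<epsilon> x y)"
      using reg \<open>set us \<subseteq> S \<times> S\<close> unfolding regular_chain_def by blast
    then show ?case using \<open>0 \<le> d\<close> by (rule comparable_cmult)
  qed (rule comparable_add)
  then show ?case using \<open>0 \<le> c\<close> by (rule comparable_cmult[OF comparable_sym])
qed (rule comparable_add)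

lemma entry_poly_mult:
  assumes "entry_poly S p a" "entry_poly S p b"
  shows "entry_poly S p (\<lambda>\<epsilon>. a \<epsilon> * b \<epsilon>)"
  using assms(1)
proof induction
  case (monom c us)
  show ?case
    using assms(2)
  proof induction
    case (monom d vs)
    have "entry_poly S p (\<lambda>\<epsilon>. (c * d) * (\<Prod>(x, y)\<leftarrow>us @ vs. p \<epsilon> x y))"
      using monom \<open>0 \<le> c\<close> \<open>set us \<subseteq> S \<times> S\<close> by (intro entry_poly.monom) auto
    then show ?case by (simp add: mult_ac)
  next
    case (add a b)
    then show ?case using entry_poly.add[OF add.IH] by (simp add: distrib_left)
  qed
next
  case (add a a')
  then show ?case using entry_poly.add[OF add.IH] by (simp add: distrib_right)
qed

lemma entry_poly_const: "0 \<le> c \<Longrightarrow> entry_poly S p (\<lambda>_. c)"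
  using entry_poly.monom[of c "[]" S p] by simp

lemma entry_poly_entry: "x \<in> S \<Longrightarrow> y \<in> S \<Longrightarrow> entry_poly S p (\<lambda>\<epsilon>. p \<epsilon> x y)"
  using entry_poly.monom[of 1 "[(x, y)]" S p] by simp

lemma entry_poly_sum:
  assumes "finite I" "\<And>i. i \<in> I \<Longrightarrow> entry_poly S p (f i)"
  shows "entry_poly S p (\<lambda>\<epsilon>. \<Sum>i\<in>I. f i \<epsilon>)"
  using assms
proof (induction I rule: finite_induct)
  case empty
  show ?case by (simp add: entry_poly_const)
next
  case (insert i I)
  then have "entry_poly S p (\<lambda>\<epsilon>. f i \<epsilon> + (\<Sum>i\<in>I. f i \<epsilon>))"
    by (intro entry_poly.add) simp_all
  with insert.hyps show ?case by simp
qed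

text \<open>Comparability gives a limit in \<open>[0, \<infinity>]\<close>; the bound by 1 makes it
  finite and hence a real limit.\<close>

lemma comparable_ratio_tendsto:
  assumes "comparable a b" and b: "\<And>\<epsilon>. 0 < \<epsilon> \<Longrightarrow> 0 < b \<epsilon>"
    and ab: "\<And>\<epsilon>. 0 < \<epsilon> \<Longrightarrow> 0 \<le> a \<epsilon> / b \<epsilon> \<and> a \<epsilon> / b \<epsilon> \<le> 1"
  shows "\<exists>l. ((\<lambda>\<epsilon>. a \<epsilon> / b \<epsilon>) \<longlongrightarrow> l) (at_right 0)"
  using assms(1)
proof (cases rule: comparable_cases)
  case 1
  have "\<forall>\<^sub>F \<epsilon> in at_right 0. a \<epsilon> / b \<epsilon> = 0"
    using eventually_at_right_less[of 0] by eventually_elim (simp add: 1)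
  then show ?thesis by (intro exI[of _ 0] tendsto_eventually)
next
  case 2
  then show ?thesis using b[of 1] by simp
next
  case (3 L)
  have ev: "\<forall>\<^sub>F \<epsilon> in at_right 0. ennreal (a \<epsilon> / b \<epsilon>) \<le> 1"
    using eventually_at_right_less[of 0]
  proof eventually_elim
    case (elim \<epsilon>)
    then show ?case using ab[of \<epsilon>] ennreal_leI[of "a \<epsilon> / b \<epsilon>" 1] by simp
  qed
  have "L \<le> 1" using tendsto_upperbound[OF 3(3) ev] by simp
  then have L: "L \<noteq> \<top>" by (auto simp: top_unique)
  have "((\<lambda>\<epsilon>. enn2real (ennreal (a \<epsilon> / b \<epsilon>))) \<longlongrightarrow> enn2real L) (at_right 0)"
    using L 3(3) by (intro tendsto_enn2real) (auto simp: less_top)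
  moreover have "\<forall>\<^sub>F \<epsilon> in at_right 0. enn2real (ennreal (a \<epsilon> / b \<epsilon>)) = a \<epsilon> / b \<epsilon>"
    using eventually_at_right_less[of 0]
  proof eventually_elim
    case (elim \<epsilon>)
    then show ?case using ab[of \<epsilon>] by (intro enn2real_ennreal) blast
  qed
  ultimately have "((\<lambda>\<epsilon>. a \<epsilon> / b \<epsilon>) \<longlongrightarrow> enn2real L) (at_right 0)"
    by (rule Lim_transform_eventually)
  then show ?thesis ..
qed

section \<open>Entries of the lifted chain as quotients of nonnegative polynomials in the original
  entries\<close>

context lifted_class
begin

definition entry_num :: "'s + 's set \<Rightarrow> 's + 's set \<Rightarrow> real \<Rightarrow> real" where
  "entry_num u v \<epsilon> = (case (u, v) of
      (Inl x, Inl y) \<Rightarrow> p \<epsilon> x y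
    | (Inl x, Inr _) \<Rightarrow> (\<Sum>z\<in>E. p \<epsilon> x z)
    | (Inr _, Inl y) \<Rightarrow> (\<Sum>z\<in>E. \<nu> z * p \<epsilon> z y)
    | (Inr _, Inr _) \<Rightarrow> 0)"

definition entry_den :: "'s + 's set \<Rightarrow> real \<Rightarrow> real" where
  "entry_den u \<epsilon> = (case u of Inl _ \<Rightarrow> 1 | Inr _ \<Rightarrow> lift_Z S p E \<epsilon>)"

lemma p'_eq_ratio: "0 < \<epsilon> \<Longrightarrow> p' \<epsilon> u v = entry_num u v \<epsilon> / entry_den u \<epsilon>"
  by (cases u; cases v) (simp_all add: p'_pos entry_num_def entry_den_def)

lemma entry_den_pos: "0 < \<epsilon> \<Longrightarrow> 0 < entry_den u \<epsilon>"
  by (cases u) (simp_all add: entry_den_def lift_Z_pos)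

lemma entry_poly_nu_mult: "z \<in> E \<Longrightarrow> y \<in> S \<Longrightarrow> entry_poly S p (\<lambda>\<epsilon>. \<nu> z * p \<epsilon> z y)"
  using nu_pos[of z] E_props(1) by (intro entry_poly_mult entry_poly_const entry_poly_entry) auto

lemma entry_poly_num:
  assumes "u \<in> S'" "v \<in> S'"
  shows "entry_poly S p (entry_num u v)"
  using assms E_props(1) finite_E
  by (elim S'_cases; simp add: entry_num_def[abs_def])
    (auto intro!: entry_poly_entry entry_poly_sum entry_poly_nu_mult entry_poly_const)

lemma entry_poly_den: "entry_poly S p (entry_den u)"
  using finite_E finite_S
  by (cases u) (auto simp: entry_den_def[abs_def] lift_Z_def
      intro!: entry_poly_sum entry_poly_nu_mult entry_poly_const)

lemma regular_perturbed_lifted: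
  assumes reg: "regular_chain S p"
  shows "perturbed_chain S' p'"
proof -
  have lim: "((\<lambda>\<epsilon>. p' \<epsilon> u v) \<longlongrightarrow> p' 0 u v) (at_right 0)" if uv: "u \<in> S'" "v \<in> S'" for u v
  proof -
    have "\<exists>l. ((\<lambda>\<epsilon>. entry_num u v \<epsilon> / entry_den u \<epsilon>) \<longlongrightarrow> l) (at_right 0)"
    proof (rule comparable_ratio_tendsto)
      show "comparable (entry_num u v) (entry_den u)"
        by (rule entry_poly_comparable[OF reg entry_poly_num[OF uv] entry_poly_den])
      show "0 \<le> entry_num u v \<epsilon> / entry_den u \<epsilon> \<and> entry_num u v \<epsilon> / entry_den u \<epsilon> \<le> 1" if "0 < \<epsilon>" for \<epsilon>
        using stochastic_nonneg[OF stochastic_p'[OF that] uv] stochastic_le_1[OF finite_S' stochastic_p'[OF that] uv]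
        by (simp add: p'_eq_ratio[OF that])
    qed (rule entry_den_pos)
    then obtain l where l: "((\<lambda>\<epsilon>. entry_num u v \<epsilon> / entry_den u \<epsilon>) \<longlongrightarrow> l) (at_right 0)" by blast
    have "\<forall>\<^sub>F \<epsilon> in at_right 0. entry_num u v \<epsilon> / entry_den u \<epsilon> = p' \<epsilon> u v"
      using eventually_at_right_less[of 0] by eventually_elim (simp add: p'_eq_ratio)
    from Lim_transform_eventually[OF l this] have l': "((\<lambda>\<epsilon>. p' \<epsilon> u v) \<longlongrightarrow> l) (at_right 0)" .
    \<comment> \<open>The value at 0 is defined by \<open>Lim\<close>, which is meaningful only now
      that a limit is known to exist.\<close>
    have "\<forall>\<^sub>F \<epsilon> in at_right 0. p' \<epsilon> u v = lifted_matrix S p E \<epsilon> u v"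
      using eventually_at_right_less[of 0] by eventually_elim (simp add: p'_pos)
    from Lim_transform_eventually[OF l' this] have "p' 0 u v = l"
      unfolding lifted_chain_def by (simp add: tendsto_Lim)
    with l' show ?thesis by simp
  qed
  have ev: "\<forall>\<^sub>F \<epsilon> in at_right 0. stochastic S' (p' \<epsilon>)"
    using eventually_at_right_less[of 0] by eventually_elim (rule stochastic_p')
  have "stochastic S' (p' 0)"
    unfolding stochastic_def
  proof (intro ballI conjI)
    fix u v assume uv: "u \<in> S'" "v \<in> S'"
    have "\<forall>\<^sub>F \<epsilon> in at_right 0. 0 \<le> p' \<epsilon> u v"
      using ev by eventually_elim (rule stochastic_nonneg[OF _ uv])
    then show "0 \<le> p' 0 u v"
      using tendsto_lowerbound[OF lim[OF uv]] by simp
  next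
    fix u assume u: "u \<in> S'"
    have "((\<lambda>\<epsilon>. \<Sum>v\<in>S'. p' \<epsilon> u v) \<longlongrightarrow> (\<Sum>v\<in>S'. p' 0 u v)) (at_right 0)"
      using u by (intro tendsto_sum lim)
    moreover have "((\<lambda>\<epsilon>. \<Sum>v\<in>S'. p' \<epsilon> u v) \<longlongrightarrow> 1) (at_right 0)"
      by (rule tendsto_eventually) (use ev u in \<open>auto elim!: eventually_mono simp: stochastic_sum\<close>)
    ultimately show "(\<Sum>v\<in>S'. p' 0 u v) = 1"
      by (rule tendsto_unique[rotated]) simp
  qed
  then have "stochastic S' (p' \<epsilon>)" if "0 \<le> \<epsilon>" for \<epsilon>
    using stochastic_p'[of \<epsilon>] that by (cases "\<epsilon> = 0") auto
  then show ?thesis using lim by (simp add: perturbed_chain_def)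
qed

lemma lifted_product_eq_ratio:
  assumes "set us \<subseteq> S' \<times> S'"
  shows "\<exists>a b. entry_poly S p a \<and> entry_poly S p b \<and> (\<forall>\<epsilon>>0. 0 < b \<epsilon>) \<and>
    (\<forall>\<epsilon>>0. (\<Prod>(u, v)\<leftarrow>us. p' \<epsilon> u v) = a \<epsilon> / b \<epsilon>)"
  using assms
proof (induction us)
  case Nil
  then show ?case by (intro exI[of _ "\<lambda>_. 1"]) (simp add: entry_poly_const)
next
  case (Cons w us)
  obtain u v where w: "w = (u, v)" "u \<in> S'" "v \<in> S'" using Cons.prems by auto
  from Cons obtain a b where ab: "entry_poly S p a" "entry_poly S p b" "\<And>\<epsilon>. 0 < \<epsilon> \<Longrightarrow> 0 < b \<epsilon>"
    "\<And>\<epsilon>. 0 < \<epsilon> \<Longrightarrow> (\<Prod>(u, v)\<leftarrow>us. p' \<epsilon> u v) = a \<epsilon> / b \<epsilon>"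
    by auto
  show ?case
  proof (intro exI conjI allI impI)
    show "entry_poly S p (\<lambda>\<epsilon>. entry_num u v \<epsilon> * a \<epsilon>)" "entry_poly S p (\<lambda>\<epsilon>. entry_den u \<epsilon> * b \<epsilon>)"
      by (intro entry_poly_mult entry_poly_num entry_poly_den ab w)+
    show "0 < entry_den u \<epsilon> * b \<epsilon>" if "0 < \<epsilon>" for \<epsilon>
      using entry_den_pos[OF that] ab(3)[OF that] by simp
    show "(\<Prod>(u, v)\<leftarrow>w # us. p' \<epsilon> u v) = entry_num u v \<epsilon> * a \<epsilon> / (entry_den u \<epsilon> * b \<epsilon>)" if "0 < \<epsilon>" for \<epsilon>
      using ab(4)[OF that] by (simp add: w(1) p'_eq_ratio[OF that])
  qed
qed

theorem regular_lifted:
  assumes reg: "regular_chain S p"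
  shows "regular_chain S' p'"
  unfolding regular_chain_def irreducibly_perturbed_chain_def
proof (intro conjI allI impI)
  show "perturbed_chain S' p'" by (rule regular_perturbed_lifted[OF reg])
  show "irreducible_chain S' (p' \<epsilon>)" if "0 < \<epsilon>" for \<epsilon> by (rule irreducible_p'[OF that])
next
  fix us vs assume "set us \<subseteq> S' \<times> S'" "set vs \<subseteq> S' \<times> S'"
  from lifted_product_eq_ratio[OF this(1)] lifted_product_eq_ratio[OF this(2)]
  obtain a b c d where poly: "entry_poly S p a" "entry_poly S p b" "entry_poly S p c" "entry_poly S p d"
    and pos: "\<And>\<epsilon>. 0 < \<epsilon> \<Longrightarrow> 0 < b \<epsilon>" "\<And>\<epsilon>. 0 < \<epsilon> \<Longrightarrow> 0 < d \<epsilon>"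
    and eq: "\<And>\<epsilon>. 0 < \<epsilon> \<Longrightarrow> (\<Prod>(u, v)\<leftarrow>us. p' \<epsilon> u v) = a \<epsilon> / b \<epsilon>"
      "\<And>\<epsilon>. 0 < \<epsilon> \<Longrightarrow> (\<Prod>(u, v)\<leftarrow>vs. p' \<epsilon> u v) = c \<epsilon> / d \<epsilon>"
    by blast
  \<comment> \<open>Cross-multiplication: \<open>a / b\<close> over \<open>c / d\<close> is the
    quotient of the two polynomials \<open>a * d\<close> and \<open>c * b\<close>.\<close>
  have "comparable (\<lambda>\<epsilon>. a \<epsilon> * d \<epsilon>) (\<lambda>\<epsilon>. c \<epsilon> * b \<epsilon>)"
    by (rule entry_poly_comparable[OF reg entry_poly_mult entry_poly_mult]) fact+
  then have "comparable (\<lambda>\<epsilon>. a \<epsilon> / b \<epsilon>) (\<lambda>\<epsilon>. c \<epsilon> / d \<epsilon>)"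
  proof (cases rule: comparable_cases)
    case 1
    then show ?thesis using pos by (intro comparable_zero(1)) fastforce
  next
    case 2
    then show ?thesis using pos by (intro comparable_zero(2)) fastforce
  next
    case (3 L)
    have "((\<lambda>\<epsilon>. ennreal (a \<epsilon> / b \<epsilon> / (c \<epsilon> / d \<epsilon>))) \<longlongrightarrow> L) (at_right 0)"
      using 3(3) by (simp add: mult.commute)
    then show ?thesis
      by (rule comparableI[rotated 2])
        (use 3(1,2) pos in \<open>auto simp: zero_less_mult_iff intro!: divide_pos_pos dest: less_asym\<close>)
  qed
  then show "comparable (\<lambda>\<epsilon>. \<Prod>(x, y)\<leftarrow>us. p' \<epsilon> x y) (\<lambda>\<epsilon>. \<Prod>(z, w)\<leftarrow>vs. p' \<epsilon> z w)"
    using comparable_cong[of "\<lambda>\<epsilon>. \<Prod>(x, y)\<leftarrow>us. p' \<epsilon> x y" "\<lambda>\<epsilon>. a \<epsilon> / b \<epsilon>"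
        "\<lambda>\<epsilon>. \<Prod>(z, w)\<leftarrow>vs. p' \<epsilon> z w" "\<lambda>\<epsilon>. c \<epsilon> / d \<epsilon>"] eq by simp
qed

end

section \<open>Transient states of the lifted chain\<close>

lemma essential_class_leads_to:
  assumes "finite S" "stochastic S P" "essential_class S P C" "x \<in> C" "y \<in> C"
  shows "leads_to S P x y"
proof -
  obtain w where w: "w \<in> S" "C = communicating S P `` {w}"
    using assms(3) by (auto simp: essential_class_def quotient_def)
  then show ?thesis
    using assms leads_to_trans[OF assms(1,2), of x w y] by (auto simp: communicating_def)
qed

text \<open>Recurrence is rephrased through reachability alone, without mention of classes, which is
  the form that can be carried from \<open>S\<close> to the lifted space.\<close>

lemma not_transient_iff:
  assumes "finite S" "stochastic S P" "x \<in> S"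
  shows "x \<notin> transient_states S P \<longleftrightarrow> (\<forall>y. leads_to S P x y \<longrightarrow> leads_to S P y x)"
proof
  assume "x \<notin> transient_states S P"
  then obtain C where C: "essential_class S P C" "x \<in> C"
    using assms(3) by (auto simp: transient_states_def)
  show "\<forall>y. leads_to S P x y \<longrightarrow> leads_to S P y x"
  proof (intro allI impI)
    fix y assume xy: "leads_to S P x y"
    then have "y \<in> C"
      using C leads_to_in[OF assms(2,3) xy] by (auto simp: essential_class_def)
    then show "leads_to S P y x" using essential_class_leads_to[OF assms(1,2) C(1)] C(2) by blast
  qed
next
  assume *: "\<forall>y. leads_to S P x y \<longrightarrow> leads_to S P y x"
  define C where "C = communicating S P `` {x}"
  have "essential_class S P C"
    unfolding essential_class_def
  proof (intro conjI ballI impI)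
    show "C \<in> S // communicating S P" unfolding C_def using assms(3) by (rule quotientI)
    fix y z assume y: "y \<in> C" and z: "z \<in> S" "leads_to S P y z"
    then have "leads_to S P x z"
      using leads_to_trans[OF assms(1-3), of y z] by (auto simp: C_def communicating_def)
    then show "z \<in> C" using * z assms(3) by (simp add: C_def communicating_def)
  qed
  moreover have "x \<in> C" using assms(3) leads_to_refl[of S P x] by (simp add: C_def communicating_def)
  ultimately show "x \<notin> transient_states S P" by (auto simp: transient_states_def)
qed

lemma leads_to_edge:
  assumes "finite S" "stochastic S P" "x \<in> S" "y \<in> S" "0 < P x y"
  shows "leads_to S P x y"
  using closed_set_reachable[OF assms(1-3)] assms(3-5) leads_to_refl[of S P x]
  by (simp add: closed_set_def)

section \<open>The limit of the lifted chain and its essential classes\<close>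

context lifted_class
begin

lemma p'_0_eq:
  assumes "((\<lambda>\<epsilon>. lifted_matrix S p E \<epsilon> u v) \<longlongrightarrow> l) (at_right 0)"
  shows "p' 0 u v = l"
  using assms by (simp add: lifted_chain_def tendsto_Lim)

text \<open>Rows outside \<open>E\<close> converge without regularity. Of the row of
  \<open>Inr E\<close> only the diagonal limit is given: it is 0, so in the limit the lifted state
  must be left at once.\<close>

lemma p'_0:
  assumes "x \<in> S - E"
  shows "y \<in> S - E \<Longrightarrow> p' 0 (Inl x) (Inl y) = p 0 x y"
    and "p' 0 (Inl x) (Inr E) = (\<Sum>z\<in>E. p 0 x z)"
    and "p' 0 (Inr E) (Inr E) = 0"
  using assms E_props(1) by (auto intro!: p'_0_eq tendsto_sum tendsto_p)

text \<open>The set \<open>R\<close> of states reachable from \<open>x\<close> under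
  \<open>p 0\<close> is closed and avoids \<open>E\<close>. On it the two limit matrices agree, so
  reachability from \<open>x\<close> and the way back to \<open>x\<close> are the same in both
  chains.\<close>

lemma not_transient_lifted:
  assumes st': "stochastic S' (p' 0)" and x: "x \<in> S - E" and nt: "x \<notin> transient_states S (p 0)"
  shows "Inl x \<notin> transient_states S' (p' 0)" and "\<not> leads_to S' (p' 0) (Inl x) (Inr E)"
proof -
  note st = stochastic_p[OF order_refl]
  have xS: "x \<in> S" and xS': "Inl x \<in> S'" using x by (auto simp: in_S')
  have recur: "leads_to S (p 0) y x" if "leads_to S (p 0) x y" for y
    using nt that not_transient_iff[OF finite_S st xS] by blast
  define R where "R = {y \<in> S. leads_to S (p 0) x y}"
  have R: "closed_set S (p 0) R" "x \<in> R"
    using closed_set_reachable[OF finite_S st xS] xS leads_to_refl[of S "p 0" x] by (auto simp: R_def)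
  \<comment> \<open>\<open>E\<close> is closed for \<open>p 0\<close> and \<open>x\<close> lies
    outside it, so a state of \<open>E\<close> reached from \<open>x\<close> could not lead
    back.\<close>
  have RE: "y \<notin> E" if "y \<in> R" for y
    using leads_to_closed_set[OF st E_props(3), of y x] recur[of y] x that by (auto simp: R_def)
  have "closed_set S' (p' 0) (Inl ` R)"
    unfolding closed_set_def
  proof (intro conjI ballI impI)
    show "Inl ` R \<subseteq> S'" using R(1) RE by (auto simp: closed_set_def in_S')
    fix u v assume "u \<in> Inl ` R" and v: "v \<in> S'" "0 < p' 0 u v"
    then obtain y where y: "u = Inl y" "y \<in> R" "y \<in> S - E" using RE by (auto simp: R_def)
    from v(1) show "v \<in> Inl ` R"
    proof (cases rule: S'_cases)
      case (1 w)
      then show ?thesis using v y R(1) p'_0(1)[OF y(3), of w] by (auto simp: closed_set_def)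
    next
      case 2
      then have "0 < (\<Sum>z\<in>E. p 0 y z)" using v y p'_0(2)[OF y(3)] by simp
      then obtain z where "z \<in> E" "0 < p 0 y z"
        using sum_nonpos[of E "p 0 y"] by (force simp: not_less[symmetric])
      then show ?thesis using R(1) RE[of z] y E_props(1) by (auto simp: closed_set_def)
    qed
  qed
  then have reach: "u \<in> Inl ` R" if "leads_to S' (p' 0) (Inl x) u" for u
    using leads_to_closed_set[OF st' _ _ that] R(2) by blast
  show "\<not> leads_to S' (p' 0) (Inl x) (Inr E)" using reach by blast
  have returns: "leads_to S' (p' 0) (Inl y) (Inl x)" if y: "y \<in> R" for y
  proof -
    have yS: "y \<in> S - E" using y RE by (auto simp: R_def)
    then have yS': "Inl y \<in> S'" by (simp add: in_S')
    \<comment> \<open>Lifting a path from \<open>y\<close> to \<open>x\<close> is replaced by a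
      closure argument: the states of \<open>R\<close> that the lifted chain reaches from
      \<open>y\<close> form a closed set of the original chain, which therefore contains
      \<open>x\<close>.\<close>
    define W where "W = {w \<in> R. leads_to S' (p' 0) (Inl y) (Inl w)}"
    have "closed_set S (p 0) W"
      unfolding closed_set_def
    proof (intro conjI ballI impI)
      show "W \<subseteq> S" by (auto simp: W_def R_def)
      fix w v assume w: "w \<in> W" and v: "v \<in> S" "0 < p 0 w v"
      then have vR: "v \<in> R" using R(1) by (auto simp: W_def closed_set_def)
      have wv: "w \<in> S - E" "v \<in> S - E" using w vR RE by (auto simp: W_def R_def)
      then have "0 < p' 0 (Inl w) (Inl v)" using p'_0(1) v by simp
      then have "leads_to S' (p' 0) (Inl w) (Inl v)"
        using wv by (intro leads_to_edge[OF finite_S' st']) (auto simp: in_S')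
      then have "leads_to S' (p' 0) (Inl y) (Inl v)"
        using w leads_to_trans[OF finite_S' st' yS'] by (auto simp: W_def)
      with vR show "v \<in> W" by (simp add: W_def)
    qed
    moreover have "y \<in> W" using y leads_to_refl by (simp add: W_def)
    moreover have "leads_to S (p 0) y x" using recur y by (simp add: R_def)
    ultimately have "x \<in> W" using leads_to_closed_set[OF st] by blast
    then show ?thesis by (simp add: W_def)
  qed
  show "Inl x \<notin> transient_states S' (p' 0)"
    unfolding not_transient_iff[OF finite_S' st' xS'] using reach returns by blast
qed

text \<open>The zero diagonal gives \<open>Inr E\<close> a successor \<open>Inl x\<close>, which
  lies in the same essential class and so leads back to \<open>Inr E\<close>. No recurrent state
  outside \<open>E\<close> can do that, so \<open>x\<close> was transient.\<close>

theorem lifted_state_transient_or_absorbs: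
  assumes st': "stochastic S' (p' 0)" and nt: "Inr E \<notin> transient_states S' (p' 0)"
  shows "\<exists>C. essential_class S' (p' 0) C \<and> Inr E \<in> C \<and>
            (\<exists>z\<in>transient_states S (p 0). Inl z \<in> C) \<and>
            card (transient_states S' (p' 0)) < card (transient_states S (p 0))"
proof -
  let ?T = "transient_states S (p 0)" and ?T' = "transient_states S' (p' 0)"
  have ES': "Inr E \<in> S'" by (simp add: in_S')
  obtain C where C: "essential_class S' (p' 0) C" "Inr E \<in> C"
    using nt ES' by (auto simp: transient_states_def)
  obtain x0 where "x0 \<in> S - E" using E_props(1) not_all by blast
  then have "(\<Sum>y\<in>S - E. p' 0 (Inr E) (Inl y)) = 1"
    using stochastic_sum[OF st' ES'] p'_0(3) by (simp add: sum_S')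
  then obtain x where x: "x \<in> S - E" "0 < p' 0 (Inr E) (Inl x)"
    using sum_nonpos[of "S - E" "\<lambda>y. p' 0 (Inr E) (Inl y)"] by (force simp: not_less[symmetric])
  then have xS': "Inl x \<in> S'" by (simp add: in_S')
  have "leads_to S' (p' 0) (Inr E) (Inl x)"
    by (rule leads_to_edge[OF finite_S' st' ES' xS' x(2)])
  then have xC: "Inl x \<in> C" using C xS' by (auto simp: essential_class_def)
  then have "leads_to S' (p' 0) (Inl x) (Inr E)"
    using essential_class_leads_to[OF finite_S' st' C(1)] C(2) by blast
  then have xT: "x \<in> ?T" using not_transient_lifted(2)[OF st' x(1)] by blast
  have "Inl x \<notin> ?T'" using C(1) xC by (auto simp: transient_states_def)
  \<comment> \<open>No state becomes newly transient: old recurrent states outside \<open>E\<close>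
    stay recurrent and \<open>Inr E\<close> is recurrent by assumption. The state \<open>x\<close>
    is lost, which makes the count drop strictly.\<close>
  have "?T' \<subseteq> Inl ` (?T - {x})"
  proof
    fix u assume u: "u \<in> ?T'"
    then have "u \<in> S'" by (simp add: transient_states_def)
    then show "u \<in> Inl ` (?T - {x})"
    proof (cases rule: S'_cases)
      case (1 y)
      with u \<open>Inl x \<notin> ?T'\<close> not_transient_lifted(1)[OF st' 1(2)] show ?thesis by blast
    qed (use u nt in simp)
  qed
  moreover have fin: "finite ?T" using finite_S by (simp add: transient_states_def)
  ultimately have "card ?T' \<le> card (Inl ` (?T - {x}) :: ('s + 's set) set)"
    by (intro card_mono) auto
  also have "\<dots> = card (?T - {x})" by (intro card_image) simp
  also have "\<dots> < card ?T" using fin xT by (rule card_Diff1_less)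
  finally show ?thesis using C xC xT by blast
qed

end

text \<open>The equivalence in a) is asserted for all families. \<open>asymptotic_to\<close> is
  asserted for entries that are identically zero or eventually positive, a property inherited by the
  hitting probabilities; regular chains have it by
  \<open>regular_chain_zero_or_positive\<close>.\<close>

theorem theorem5p2:
  fixes S :: "'s set" and E :: "'s set" and p :: "real \<Rightarrow> 's \<Rightarrow> 's \<Rightarrow> real"
  assumes "finite S"
    and "irreducibly_perturbed_chain S p"
    and "essential_class S (p 0) E"
    and "E \<noteq> S"
  shows
    "let S' = lifted_space S E; p' = lifted_chain S p E in
     (\<forall>A B. A \<subseteq> S - E \<longrightarrow> B \<subseteq> S - E \<longrightarrow>
       (\<forall>z\<in>S - E.
          (\<lambda>\<epsilon>. prob_hits_before S (p \<epsilon>) z B A) \<sim>[at_right 0]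
            (\<lambda>\<epsilon>. prob_hits_before S' (p' \<epsilon>) (Inl z) (Inl ` B) (Inl ` A))) \<and>
       (\<forall>z\<in>E.
          (\<lambda>\<epsilon>. prob_hits_before S (p \<epsilon>) z B A) \<sim>[at_right 0]
            (\<lambda>\<epsilon>. prob_hits_before S' (p' \<epsilon>) (Inr E) (Inl ` B) (Inl ` A))) \<and>
       ((\<forall>x\<in>S. \<forall>y\<in>S. zero_or_positive (\<lambda>\<epsilon>. p \<epsilon> x y)) \<longrightarrow>
         (\<forall>z\<in>S - E.
            asymptotic_to (\<lambda>\<epsilon>. prob_hits_before S (p \<epsilon>) z B A)
              (\<lambda>\<epsilon>. prob_hits_before S' (p' \<epsilon>) (Inl z) (Inl ` B) (Inl ` A))) \<and>
         (\<forall>z\<in>E.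
            asymptotic_to (\<lambda>\<epsilon>. prob_hits_before S (p \<epsilon>) z B A)
              (\<lambda>\<epsilon>. prob_hits_before S' (p' \<epsilon>) (Inr E) (Inl ` B) (Inl ` A))))) \<and>
     (regular_chain S p \<longrightarrow> regular_chain S' p') \<and>
     (regular_chain S p \<longrightarrow>
       Inr E \<in> transient_states S' (p' 0) \<or>
       (\<exists>C. essential_class S' (p' 0) C \<and> Inr E \<in> C \<and>
            (\<exists>z\<in>transient_states S (p 0). Inl z \<in> C) \<and>
            card (transient_states S' (p' 0)) < card (transient_states S (p 0))))"
proof -
  interpret lifted_class S E p
    by unfold_locales fact+
  show ?thesis
    unfolding Let_def
  proof (intro conjI allI ballI impI)
    fix A B z assume AB: "A \<subseteq> S - E" "B \<subseteq> S - E"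
    {
      assume "z \<in> S - E"
      then have z: "z \<in> S" "z \<notin> E" by auto
      show "(\<lambda>\<epsilon>. prob_hits_before S (p \<epsilon>) z B A) \<sim>[at_right 0]
          (\<lambda>\<epsilon>. prob_hits_before S' (p' \<epsilon>) (Inl z) (Inl ` B) (Inl ` A))"
        using hits_before_asymp_equiv[OF AB z(1)] z(2) by simp
      assume zp: "\<forall>x\<in>S. \<forall>y\<in>S. zero_or_positive (\<lambda>\<epsilon>. p \<epsilon> x y)"
      show "asymptotic_to (\<lambda>\<epsilon>. prob_hits_before S (p \<epsilon>) z B A)
          (\<lambda>\<epsilon>. prob_hits_before S' (p' \<epsilon>) (Inl z) (Inl ` B) (Inl ` A))"
        using hits_before_asymptotic_to[OF AB z(1) zp] z(2) by simp
    next
      assume zE: "z \<in> E"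
      then have z: "z \<in> S" using E_props(1) by blast
      show "(\<lambda>\<epsilon>. prob_hits_before S (p \<epsilon>) z B A) \<sim>[at_right 0]
          (\<lambda>\<epsilon>. prob_hits_before S' (p' \<epsilon>) (Inr E) (Inl ` B) (Inl ` A))"
        using hits_before_asymp_equiv[OF AB z] zE by simp
      assume zp: "\<forall>x\<in>S. \<forall>y\<in>S. zero_or_positive (\<lambda>\<epsilon>. p \<epsilon> x y)"
      show "asymptotic_to (\<lambda>\<epsilon>. prob_hits_before S (p \<epsilon>) z B A)
          (\<lambda>\<epsilon>. prob_hits_before S' (p' \<epsilon>) (Inr E) (Inl ` B) (Inl ` A))"
        using hits_before_asymptotic_to[OF AB z zp] zE by simp
    }
  next
    assume reg: "regular_chain S p"
    then show "regular_chain S' p'" by (rule regular_lifted)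
    have "stochastic S' (p' 0)"
      using regular_perturbed_lifted[OF reg] by (simp add: perturbed_chain_def)
    then show "Inr E \<in> transient_states S' (p' 0) \<or>
       (\<exists>C. essential_class S' (p' 0) C \<and> Inr E \<in> C \<and>
            (\<exists>z\<in>transient_states S (p 0). Inl z \<in> C) \<and>
            card (transient_states S' (p' 0)) < card (transient_states S (p 0)))"
      using lifted_state_transient_or_absorbs by blast
  qed
qed

end
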